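(* Let $m\ge 2$, $n\ge 3$, $W=G(m,1,n)$. The internal zonotopal ideal $I_{\mathcal G^\perp,-2}\subset\mathrm{Sym}(K)$ equals $J_1+J_2$, where \[ J_1=\langle y_{ij}^ky_{ij}^{k'}:1\le i<j\le n,\ 0\le k,k'<m\rangle \] and $J_2$ is the smallest $W$-stable ideal of $\mathrm{Sym}(K)$ containing the element $y_{ij}^0y_{jk}^0+y_{ik}^0y_{kj}^0+y_{ji}^0y_{ik}^0$ for some (equivalently, any) pairwise distinct $i,j,k\in[n]$. (Also, $J_1$ is the smallest $W$-stable ideal containing the elements $y_{12}^ky_{12}^{k'}$, $0\le k,k'\le m-1$.)
   Context: $\omega=e^{2\pi i/m}$. $G(m,1,n)$ is the group of $n\times n$ monomial matrices whose nonzero entries are $m$-th roots of unity, acting on $\mathbf C^n$ (standard basis $e_i$); it contains the permutation matrices ($\pi e_i=e_{\pi(i)}$) and the diagonal matrices $g_i$ with $i$-th entry $\omega$, others $1$. $\mathbf C^{\mathcal G}$ has basis $h_i$ ($1\le i\le n$), $h_{ij}^k$ ($1\le i<j\le n$, $0\le k<m$); $\varphi:\mathbf C^{\mathcal G}\to\mathbf C^n$ sends $h_i\mapsto e_i$, $h_{ij}^k\mapsto e_i-\omega^ke_j$ (normals of the reflection arrangement $\mathcal G$ of $W$: $x_i=0$, $x_i-\omega^kx_j=0$). $K=\ker\varphi$ has basis $y_{ij}^k=h_i-\omega^kh_j-h_{ij}^k$ ($1\le i<j\le n$, $0\le k<m$); superscripts are read modulo $m$ and $y_{ji}^k:=-\omega^ky_{ij}^{-k}$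 (so $y_{ji}^0=-y_{ij}^0$). $\mathcal G^\perp$ is the arrangement in $K$ of hyperplanes $\ker(h^*|_K)$, $h^*$ the coordinate functionals on $\mathbf C^{\mathcal G}$. Each $w\in W$ maps each $v\in\{e_i\}\cup\{e_i-\omega^ke_j\}$ to $c_wv'$ with $v'$ in that set; $wh_v=c_wh_{v'}$ defines an action of $W$ with $\varphi$ equivariant, hence an action on $K$ and $\mathrm{Sym}(K)$. Explicitly $\pi y_{ij}^k=y_{\pi(i)\pi(j)}^k$, $g_iy_{ij}^k=\omega y_{ij}^{k-1}$, $g_jy_{ij}^k=y_{ij}^{k+1}$, $g_\ell y_{ij}^k=y_{ij}^k$ for $\ell\notin\{i,j\}$. Internal zonotopal ideal: for a finite set $\mathcal A$ of linear hyperplanes in a finite-dimensional complex vector space $U$ and $u\in U$, $\rho_{\mathcal A}(u)$ is the number of hyperplanes of $\mathcal A$ not containing $u$; $I_{\mathcal A,-2}\subset\mathrm{Sym}(U)$ is generated by $u^{\max\{\rho_{\mathcal A}(u)-1,0\}}$, $u\in U$.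
   Formalization: The generators u^{max{ρ(u)-1,0}} of the internal zonotopal ideal are taken over nonzero u only; read literally, u = 0 would contribute 0^0 = 1 and make the ideal all of Sym(K), so that the equality with J_1+J_2 would fail. *)

theory Defs
  imports Complex_Main "HOL-Library.Poly_Mapping" "HOL-Algebra.Ideal" "Jordan_Normal_Form.Matrix"
begin

section \<open>Symmetric algebras of subspaces of a coordinate space\<close>

text \<open>
  A vector of \<open>C\<^sup>X\<close> is a finitely supported map \<open>X \<Rightarrow>\<^sub>0 complex\<close>, and \<open>Sym(C\<^sup>X)\<close> is the
  polynomial ring with one variable for each basis vector.
\<close>

type_synonym 'x cvec = "'x \<Rightarrow>\<^sub>0 complex"
type_synonym 'x cpoly = "('x \<Rightarrow>\<^sub>0 nat) \<Rightarrow>\<^sub>0 complex"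

definition cvec_scale :: "complex \<Rightarrow> 'x cvec \<Rightarrow> 'x cvec" where
  "cvec_scale c v = Poly_Mapping.map ((*) c) v"

definition Const :: "complex \<Rightarrow> 'x cpoly" where
  "Const c = Poly_Mapping.single 0 c"

definition Var :: "'x \<Rightarrow> 'x cpoly" where
  "Var x = Poly_Mapping.single (Poly_Mapping.single x 1) 1"

definition linear_form :: "'x cvec \<Rightarrow> 'x cpoly" where
  "linear_form v = (\<Sum>x\<in>Poly_Mapping.keys v. Const (Poly_Mapping.lookup v x) * Var x)"

text \<open>
  For a subspace \<open>U\<close> of \<open>C\<^sup>X\<close>, the natural map \<open>Sym(U) \<rightarrow> Sym(C\<^sup>X)\<close> is injective, so \<open>Sym(U)\<close> is
  the subalgebra of the polynomial ring generated by the linear forms in \<open>U\<close>.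
\<close>

inductive_set sym_carrier :: "'x cvec set \<Rightarrow> 'x cpoly set" for U :: "'x cvec set" where
  const: "Const c \<in> sym_carrier U"
| linear: "u \<in> U \<Longrightarrow> linear_form u \<in> sym_carrier U"
| add: "p \<in> sym_carrier U \<Longrightarrow> q \<in> sym_carrier U \<Longrightarrow> p + q \<in> sym_carrier U"
| mult: "p \<in> sym_carrier U \<Longrightarrow> q \<in> sym_carrier U \<Longrightarrow> p * q \<in> sym_carrier U"

definition Sym :: "'x cvec set \<Rightarrow> 'x cpoly ring" where
  "Sym U = \<lparr>carrier = sym_carrier U, monoid.mult = (*), one = 1, ring.zero = 0, ring.add = (+)\<rparr>"

text \<open>The algebra endomorphism of \<open>Sym(C\<^sup>X)\<close> induced by the linear map sending the basis vector
  of \<open>x\<close> to \<open>f x\<close>.\<close>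

definition sym_map :: "('x \<Rightarrow> 'x cvec) \<Rightarrow> 'x cpoly \<Rightarrow> 'x cpoly" where
  "sym_map f p = (\<Sum>t\<in>Poly_Mapping.keys p. Const (Poly_Mapping.lookup p t) *
     (\<Prod>x\<in>Poly_Mapping.keys t. linear_form (f x) ^ Poly_Mapping.lookup t x))"

section \<open>Internal zonotopal ideals\<close>

text \<open>A hyperplane of \<open>U\<close> is given by its set of points, so an arrangement is a set of subsets of
  \<open>U\<close>, without multiplicities.\<close>

definition rho :: "'x cvec set set \<Rightarrow> 'x cvec \<Rightarrow> nat" where
  "rho A u = card {H \<in> A. u \<notin> H}"

text \<open>
  Subtraction on \<open>nat\<close> is truncated, so the exponent is \<open>max {\<rho>(u) - 1, 0}\<close>. The vector \<open>u = 0\<close> is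
  excluded: it would contribute \<open>0 ^ 0 = 1\<close> and make every such ideal the whole ring.
\<close>

definition internal_zonotopal_ideal :: "'x cvec set \<Rightarrow> 'x cvec set set \<Rightarrow> 'x cpoly set" where
  "internal_zonotopal_ideal U A =
     genideal (Sym U) {linear_form u ^ (rho A u - 1) | u. u \<in> U \<and> u \<noteq> 0}"

section \<open>The group \<open>G(m,1,n)\<close> and its reflection arrangement\<close>

text \<open>Indices from \<open>[n]\<close> are shifted to \<open>{0..<n}\<close>.\<close>

definition omega :: "nat \<Rightarrow> complex" where
  "omega m = exp (2 * complex_of_real pi * \<i> / of_nat m)"

definition Gm1n :: "nat \<Rightarrow> nat \<Rightarrow> complex mat set" where
  "Gm1n m n = {w \<in> carrier_mat n n.
     (\<forall>i<n. \<exists>!j. j < n \<and> w $$ (i, j) \<noteq> 0) \<and>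
     (\<forall>j<n. \<exists>!i. i < n \<and> w $$ (i, j) \<noteq> 0) \<and>
     (\<forall>i<n. \<forall>j<n. w $$ (i, j) \<noteq> 0 \<longrightarrow> w $$ (i, j) ^ m = 1)}"

text \<open>\<open>Coord i\<close> and \<open>Diff i j k\<close> index the basis vectors \<open>h\<^sub>i\<close> and \<open>h\<^sub>i\<^sub>j\<^sup>k\<close>.\<close>

datatype refl = Coord nat | Diff nat nat nat

definition refls :: "nat \<Rightarrow> nat \<Rightarrow> refl set" where
  "refls m n = {Coord i | i. i < n} \<union> {Diff i j k | i j k. i < j \<and> j < n \<and> k < m}"

fun normal_vec :: "nat \<Rightarrow> nat \<Rightarrow> refl \<Rightarrow> complex vec" where
  "normal_vec m n (Coord i) = unit_vec n i"
| "normal_vec m n (Diff i j k) = unit_vec n i - omega m ^ k \<cdot>\<^sub>v unit_vec n j"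

definition phi :: "nat \<Rightarrow> nat \<Rightarrow> refl cvec \<Rightarrow> complex vec" where
  "phi m n v = vec n (\<lambda>r. \<Sum>g\<in>Poly_Mapping.keys v. Poly_Mapping.lookup v g * normal_vec m n g $ r)"

definition Ker :: "nat \<Rightarrow> nat \<Rightarrow> refl cvec set" where
  "Ker m n = {v. Poly_Mapping.keys v \<subseteq> refls m n \<and> phi m n v = 0\<^sub>v n}"

definition G_perp :: "nat \<Rightarrow> nat \<Rightarrow> refl cvec set set" where
  "G_perp m n = {{u \<in> Ker m n. Poly_Mapping.lookup u g = 0} | g. g \<in> refls m n}"

definition hvec :: "refl \<Rightarrow> refl cvec" where
  "hvec g = Poly_Mapping.single g 1"

text \<open>Superscripts are read modulo \<open>m\<close>; for \<open>j < i\<close> the second case is \<open>y\<^sub>i\<^sub>j\<^sup>k = - \<omega>\<^sup>k y\<^sub>j\<^sub>i\<^sup>-\<^sup>k\<close>, with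
  \<open>y\<^sub>j\<^sub>i\<^sup>-\<^sup>k\<close> written out.\<close>

definition y_upper :: "nat \<Rightarrow> nat \<Rightarrow> nat \<Rightarrow> int \<Rightarrow> refl cvec" where
  "y_upper m i j k =
     hvec (Coord i) - cvec_scale (omega m powi k) (hvec (Coord j)) - hvec (Diff i j (nat (k mod int m)))"

definition yvec :: "nat \<Rightarrow> nat \<Rightarrow> nat \<Rightarrow> int \<Rightarrow> refl cvec" where
  "yvec m i j k =
     (if i < j then y_upper m i j k else - cvec_scale (omega m powi k) (y_upper m j i (- k)))"

definition yform :: "nat \<Rightarrow> nat \<Rightarrow> nat \<Rightarrow> int \<Rightarrow> refl cpoly" where
  "yform m i j k = linear_form (yvec m i j k)"

section \<open>The action of the group\<close>

text \<open>The image \<open>w h\<^sub>g = c h\<^sub>g\<^sub>'\<close>, where \<open>w\<close> maps the normal of \<open>g\<close> to \<open>c\<close> times the normal of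
  \<open>g'\<close>. No two normals are proportional, so \<open>c\<close> and \<open>g'\<close> are unique.\<close>

definition act_basis :: "nat \<Rightarrow> nat \<Rightarrow> complex mat \<Rightarrow> refl \<Rightarrow> refl cvec" where
  "act_basis m n w g = (THE v. \<exists>c. \<exists>g'\<in>refls m n.
     w *\<^sub>v normal_vec m n g = c \<cdot>\<^sub>v normal_vec m n g' \<and> v = cvec_scale c (hvec g'))"

definition act :: "nat \<Rightarrow> nat \<Rightarrow> complex mat \<Rightarrow> refl cpoly \<Rightarrow> refl cpoly" where
  "act m n w = sym_map (act_basis m n w)"

definition W_stable :: "nat \<Rightarrow> nat \<Rightarrow> refl cpoly set \<Rightarrow> bool" where
  "W_stable m n I \<longleftrightarrow> (\<forall>w\<in>Gm1n m n. \<forall>p\<in>I. act m n w p \<in> I)"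

definition W_ideal :: "nat \<Rightarrow> nat \<Rightarrow> refl cpoly set \<Rightarrow> refl cpoly set" where
  "W_ideal m n S = \<Inter>{I. ideal I (Sym (Ker m n)) \<and> W_stable m n I \<and> S \<subseteq> I}"

definition J1 :: "nat \<Rightarrow> nat \<Rightarrow> refl cpoly set" where
  "J1 m n = genideal (Sym (Ker m n))
     {yform m i j (int k) * yform m i j (int k') | i j k k'. i < j \<and> j < n \<and> k < m \<and> k' < m}"

definition J2 :: "nat \<Rightarrow> nat \<Rightarrow> nat \<Rightarrow> nat \<Rightarrow> nat \<Rightarrow> refl cpoly set" where
  "J2 m n i j k = W_ideal m n
     {yform m i j 0 * yform m j k 0 + yform m i k 0 * yform m k j 0 + yform m j i 0 * yform m i k 0}"

end

theory Submission
  imports Defs "HOL-Library.Multiset"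
begin

text \<open>
  The number \<open>\<rho>(u)\<close> is the number of nonzero coordinates of \<open>u\<close>. Vectors of \<open>K\<close> with at most three
  nonzero coordinates have square in the zonotopal ideal; applied to \<open>y\<^sub>i\<^sub>j\<^sup>k\<close>, \<open>y\<^sub>i\<^sub>j\<^sup>k - y\<^sub>i\<^sub>j\<^sup>l\<close> and
  \<open>t = y\<^sub>i\<^sub>v\<^sup>p + \<omega>\<^sup>p y\<^sub>v\<^sub>j\<^sup>q - y\<^sub>i\<^sub>j\<^sup>p\<^sup>+\<^sup>q\<close> this yields the generators of \<open>J\<^sub>1\<close> and the \<open>W\<close>-orbit of the
  generator of \<open>J\<^sub>2\<close>.

  Conversely, \<open>u\<close> is a linear combination of edges \<open>y\<^sub>i\<^sub>j\<^sup>k\<close> of a multigraph on \<open>[n]\<close>, and its coordinate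
  at \<open>h\<^sub>i\<close> is the net flow at the vertex \<open>i\<close>. Modulo \<open>J\<^sub>1 + J\<^sub>2\<close>, eliminating vertices one by one shows
  that a product of at least \<open>|C|\<close> edges with ends in \<open>C\<close> vanishes. Removing an edge at a leaf lowers
  \<open>\<rho>(u)\<close> by at least one and removes a summand of square zero, so one may assume that there are no leaves. Then
  there are at least as many edges as vertices, and \<open>\<rho>(u) - 1\<close> is at least the number of vertices
  unless \<open>u\<close> is balanced on a graph with all degrees two. In that case vertices are removed by
  subtracting multiples of triangles \<open>t\<close>, whose squares vanish.
\<close>

section \<open>Flows with values in an algebra with triangle relations\<close>

lemma powi_mod_root_of_unity:
  fixes z :: complex
  assumes "z \<noteq> 0" "z ^ m = 1"
  shows "z powi (p mod int m) = z powi p"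
proof -
  have "z powi p = z powi (int m * (p div int m) + p mod int m)"
    by simp
  also have "\<dots> = z powi (p mod int m)"
    unfolding power_int_add[OF disjI1[OF assms(1)]] power_int_mult power_int_of_nat assms(2) by simp
  finally show ?thesis by simp
qed

section \<open>Ideals of a subring and powers modulo an ideal\<close>

locale subring_ideal =
  fixes S J :: "'r::comm_ring_1 set"
  assumes one_mem: "1 \<in> S"
    and add_mem: "p \<in> S \<Longrightarrow> q \<in> S \<Longrightarrow> p + q \<in> S"
    and uminus_mem: "p \<in> S \<Longrightarrow> - p \<in> S"
    and mult_mem: "p \<in> S \<Longrightarrow> q \<in> S \<Longrightarrow> p * q \<in> S"
    and ideal_subset: "J \<subseteq> S"
    and ideal_zero: "0 \<in> J"
    and ideal_add: "p \<in> J \<Longrightarrow> q \<in> J \<Longrightarrow> p + q \<in> J"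
    and ideal_mult: "p \<in> S \<Longrightarrow> q \<in> J \<Longrightarrow> p * q \<in> J"
begin

lemma zero_mem: "0 \<in> S"
  using ideal_subset ideal_zero by auto

lemma power_mem: "p \<in> S \<Longrightarrow> p ^ k \<in> S"
  by (induction k) (auto intro: one_mem mult_mem)

lemma sum_mem: "(\<And>x. x \<in> A \<Longrightarrow> f x \<in> S) \<Longrightarrow> sum f A \<in> S"
  by (induction A rule: infinite_finite_induct) (auto intro: zero_mem add_mem)

lemma of_nat_mem: "of_nat k \<in> S"
  by (induction k) (auto intro: zero_mem one_mem add_mem)

lemma ideal_uminus: "p \<in> J \<Longrightarrow> - p \<in> J"
  using ideal_mult[of "-1" p] uminus_mem[OF one_mem] by simp

lemma ideal_diff: "p \<in> J \<Longrightarrow> q \<in> J \<Longrightarrow> p - q \<in> J"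
  using ideal_add[of p "- q"] ideal_uminus[of q] by simp

lemma ideal_sum: "(\<And>x. x \<in> A \<Longrightarrow> f x \<in> J) \<Longrightarrow> sum f A \<in> J"
  by (induction A rule: infinite_finite_induct) (auto intro: ideal_zero ideal_add)

lemma ideal_power_mono:
  assumes "u \<in> S" "u ^ k \<in> J" "k \<le> l"
  shows "u ^ l \<in> J"
proof -
  have "u ^ l = u ^ (l - k) * u ^ k"
    using assms(3) by (simp flip: power_add)
  then show ?thesis
    using ideal_mult power_mem assms by simp
qed

text \<open>Modulo \<open>t ^ 2\<close> the binomial expansion stops after the linear term, and both
  remaining terms are multiples of \<open>u ^ k\<close>. Adding a summand of square zero thus costs
  one in the exponent.\<close>

lemma ideal_power_add_square_zero:
  assumes u: "u \<in> S" and t: "t \<in> S" and t2: "t ^ 2 \<in> J" and uk: "u ^ k \<in> J"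
  shows "(u + t) ^ Suc k \<in> J"
proof -
  have *: "(u + t) ^ Suc l - u ^ Suc l - of_nat (Suc l) * u ^ l * t \<in> J" for l
  proof (induction l)
    case 0
    then show ?case by (simp add: ideal_zero)
  next
    case (Suc l)
    have "(u + t) ^ Suc (Suc l) - u ^ Suc (Suc l) - of_nat (Suc (Suc l)) * u ^ Suc l * t
        = (u + t) * ((u + t) ^ Suc l - u ^ Suc l - of_nat (Suc l) * u ^ l * t)
          + (of_nat (Suc l) * u ^ l) * t ^ 2"
      by (simp add: algebra_simps power2_eq_square)
    also have "\<dots> \<in> J"
      using Suc u t t2 by (intro ideal_add ideal_mult mult_mem add_mem of_nat_mem power_mem)
    finally show ?case .
  qed
  have "(u + t) ^ Suc k = ((u + t) ^ Suc k - u ^ Suc k - of_nat (Suc k) * u ^ k * t)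
      + (u + of_nat (Suc k) * t) * u ^ k"
    by (simp add: algebra_simps)
  also have "\<dots> \<in> J"
    using *[of k] uk u t by (intro ideal_add ideal_mult mult_mem add_mem of_nat_mem) auto
  finally show ?thesis .
qed

end

text \<open>Models the complete graph on \<open>n\<close> vertices with edges labelled by residues
  modulo \<open>m\<close>; reversing an edge negates its label. \<open>J\<close> is a parameter
  because the argument is applied to several ideals. \<open>parallel\<close> and
  \<open>triangle\<close> abstract the generators of J_1 and the twisted generators of J_2, the
  latter rewritten by skewness so that all edges follow the order \<open>i\<close>,
  \<open>v\<close>, \<open>j\<close>.\<close>

locale gain_algebra = subring_ideal S J for S J :: "'r::comm_ring_1 set" +
  fixes cst :: "complex \<Rightarrow> 'r" and \<omega> :: complex and m n :: nat and y :: "nat \<Rightarrow> nat \<Rightarrow> int \<Rightarrow> 'r"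
  assumes m_pos: "0 < m" and root: "\<omega> ^ m = 1"
    and primitive: "\<omega> powi p = \<omega> powi q \<Longrightarrow> p mod int m = q mod int m"
    and cst_mem: "cst c \<in> S"
    and cst_add: "cst (a + b) = cst a + cst b"
    and cst_mult: "cst (a * b) = cst a * cst b"
    and cst_1: "cst 1 = 1"
    and y_mem: "i < n \<Longrightarrow> j < n \<Longrightarrow> i \<noteq> j \<Longrightarrow> y i j k \<in> S"
    and y_mod: "y i j (k mod int m) = y i j k"
    and y_skew: "i \<noteq> j \<Longrightarrow> y i j k = - (cst (\<omega> powi k) * y j i (- k))"
    and parallel: "i < n \<Longrightarrow> j < n \<Longrightarrow> i \<noteq> j \<Longrightarrow> y i j p * y i j q \<in> J"
    and triangle: "i < n \<Longrightarrow> v < n \<Longrightarrow> j < n \<Longrightarrow> distinct [i, v, j] \<Longrightarrow>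
      y i v p * y v j q - y i j (p + q) * y v j q - cst (\<omega> powi (- p)) * (y i v p * y i j (p + q)) \<in> J"
begin

lemma omega_nz: "\<omega> \<noteq> 0"
  using root m_pos by (metis power_0_left less_numeral_extra(3) zero_neq_one)

lemma powi_add: "\<omega> powi (p + q) = \<omega> powi p * \<omega> powi q"
  using omega_nz by (simp add: power_int_add)

lemma powi_mod: "\<omega> powi (p mod int m) = \<omega> powi p"
  by (rule powi_mod_root_of_unity[OF omega_nz root])

lemma cst_0: "cst 0 = 0"
  using cst_add[of 0 0] by simp

lemma cst_uminus: "cst (- a) = - cst a"
  using cst_add[of a "- a"] by (simp add: cst_0 eq_neg_iff_add_eq_0 add.commute)

lemma cst_powi_inverse: "cst (\<omega> powi p) * cst (\<omega> powi (- p)) = 1"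
  using powi_add[of p "- p"] by (simp flip: cst_mult add: cst_1)

text \<open>The path from \<open>i\<close> over \<open>v\<close> to \<open>j\<close> minus the
  direct edge with the total label. The net flow cancels at all three vertices, so in K only three
  edge coordinates survive.\<close>

definition tri :: "nat \<Rightarrow> nat \<Rightarrow> nat \<Rightarrow> int \<Rightarrow> int \<Rightarrow> 'r" where
  "tri i v j p q = y i v p + cst (\<omega> powi p) * y v j q - y i j (p + q)"

text \<open>The squares of the three edges are parallel products, and the mixed terms add up to
  \<open>2 * w\<close> times the triangle relation once \<open>2 * a * c\<close> is rewritten with
  \<open>w * w' = 1\<close>.\<close>

lemma tri_square:
  assumes "i < n" "v < n" "j < n" "distinct [i, v, j]"
  shows "(tri i v j p q)\<^sup>2 \<in> J"
proof -
  define a b c where "a = y i v p" and "b = y v j q" and "c = y i j (p + q)"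
  define w w' where "w = cst (\<omega> powi p)" and "w' = cst (\<omega> powi (- p))"
  have w: "w * w' = 1"
    unfolding w_def w'_def by (rule cst_powi_inverse)
  have "(tri i v j p q)\<^sup>2 = (a + w * b - c)\<^sup>2"
    by (simp add: tri_def a_def b_def c_def w_def)
  also have "\<dots> = a * a + (w * w) * (b * b) + c * c + 2 * w * (a * b - c * b) - 2 * a * c"
    by (simp add: algebra_simps power2_eq_square)
  also have "2 * a * c = 2 * w * w' * a * c"
    using w by (simp add: mult.assoc)
  also have "a * a + (w * w) * (b * b) + c * c + 2 * w * (a * b - c * b) - 2 * w * w' * a * c
      = a * a + (w * w) * (b * b) + c * c + (of_nat 2 * w) * (a * b - c * b - w' * (a * c))"
    by (simp add: algebra_simps)
  also have "\<dots> \<in> J"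
    using assms triangle[of i v j p q] unfolding a_def b_def c_def w_def w'_def
    by (intro ideal_add ideal_mult parallel mult_mem cst_mem of_nat_mem) auto
  finally show ?thesis .
qed

section \<open>Vanishing of long products of edges\<close>

fun Y :: "nat \<times> nat \<times> int \<Rightarrow> 'r" where
  "Y (i, j, k) = y i j k"

definition edges :: "nat set \<Rightarrow> (nat \<times> nat \<times> int) set" where
  "edges C = {(i, j, k). i \<in> C \<and> j \<in> C \<and> i \<noteq> j}"

text \<open>Skewness orients any edge at \<open>v\<close> towards \<open>v\<close> at the price of a
  scalar; \<open>edge_at'\<close> orients it away from \<open>v\<close>. Two edges at
  \<open>v\<close> can then be read as a path through \<open>v\<close>.\<close>

lemma edge_at:
  assumes "e \<in> edges C" "fst e = v \<or> fst (snd e) = v"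
  obtains c i p where "i \<in> C" "i \<noteq> v" "Y e = cst c * y i v p"
proof -
  obtain a b k where e: "e = (a, b, k)" by (cases e)
  show ?thesis
  proof (cases "b = v")
    case True
    then show ?thesis
      using assms e that[of a 1 k] by (auto simp: edges_def cst_1)
  next
    case False
    then have "a = v" "b \<in> C" "v \<noteq> b" using assms e by (auto simp: edges_def)
    then show ?thesis
      using that[of b "- (\<omega> powi k)" "- k"] y_skew[of v b k] e by (auto simp: cst_uminus)
  qed
qed

lemma edge_at':
  assumes "e \<in> edges C" "fst e = v \<or> fst (snd e) = v"
  obtains c j q where "j \<in> C" "j \<noteq> v" "Y e = cst c * y v j q"
proof -
  obtain c i p where *: "i \<in> C" "i \<noteq> v" "Y e = cst c * y i v p"
    using edge_at[OF assms] .
  then show ?thesis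
    using that[of i "- (c * \<omega> powi p)" "- p"] y_skew[of i v p] by (auto simp: cst_uminus cst_mult)
qed

lemma Y_mem: "C \<subseteq> {..<n} \<Longrightarrow> e \<in> edges C \<Longrightarrow> Y e \<in> S"
  by (auto simp: edges_def intro!: y_mem)

lemma prod_mem:
  assumes "C \<subseteq> {..<n}" "set_mset M \<subseteq> edges C"
  shows "(\<Prod>e\<in>#M. Y e) \<in> S"
  using assms(2) by (induction M) (auto intro: one_mem mult_mem Y_mem[OF assms(1)])

text \<open>Repeated use of the triangle relation leaves at most one factor at a given vertex \<open>v\<close>; the
  remaining factors avoid \<open>v\<close>.\<close>

lemma prod_edges_vanish:
  assumes "C \<subseteq> {..<n}" "C \<noteq> {}" "set_mset M \<subseteq> edges C" "card C \<le> size M"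
  shows "(\<Prod>e\<in>#M. Y e) \<in> J"
  using assms
proof (induction "card C" arbitrary: C M rule: less_induct)
  case (less C)
  note C = \<open>C \<subseteq> {..<n}\<close> and outer = less.hyps
  have fin: "finite C" by (rule finite_subset[OF C]) simp
  obtain v where v: "v \<in> C" using \<open>C \<noteq> {}\<close> by auto
  let ?at = "\<lambda>e :: nat \<times> nat \<times> int. fst e = v \<or> fst (snd e) = v"
  show ?case
    using less.prems(3,4)
  proof (induction "size (filter_mset ?at M)" arbitrary: M rule: less_induct)
    case (less M)
    let ?F = "filter_mset ?at M" and ?G = "filter_mset (\<lambda>e. \<not> ?at e) M"
    have M: "M = ?F + ?G" by (rule multiset_partition)
    have FE: "set_mset ?F \<subseteq> edges C" and GE: "set_mset ?G \<subseteq> edges (C - {v})"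
      using less.prems(1) by (auto simp: edges_def)
    show ?case
    proof (cases "size ?F \<le> 1")
      \<comment> \<open>At least \<open>card C - 1\<close> factors avoid \<open>v\<close>, and the
        outer induction applies to them.\<close>
      case True
      have "size M = size ?F + size ?G" using M by (metis size_union)
      then have sz: "card (C - {v}) \<le> size ?G"
        using True less.prems v fin by (simp add: card_Diff_singleton)
      \<comment> \<open>A single vertex carries no edge, but \<open>M\<close> is nonempty.\<close>
      have "C - {v} \<noteq> {}"
      proof
        assume "C - {v} = {}"
        then have "edges C = {}" by (auto simp: edges_def)
        then have "M = {#}" using less.prems by auto
        then show False using less.prems fin v by (auto simp: card_eq_0_iff)
      qed
      then have G: "(\<Prod>e\<in>#?G. Y e) \<in> J"
        using sz GE C v fin by (intro outer[of "C - {v}"] card_Diff1_less) auto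
      have "(\<Prod>e\<in>#M. Y e) = (\<Prod>e\<in>#?F. Y e) * (\<Prod>e\<in>#?G. Y e)"
        using arg_cong[OF M, of "\<lambda>N. \<Prod>e\<in>#N. Y e"] by (simp only: image_mset_union prod_mset.union)
      then show ?thesis
        using G prod_mem[OF C FE] ideal_mult by simp
    next
      case False
      then obtain e1 F1 where F1: "?F = add_mset e1 F1"
        by (cases ?F) auto
      with False obtain e2 F2 where F2: "F1 = add_mset e2 F2"
        by (cases F1) auto
      define R where "R = F2 + ?G"
      have MR: "M = add_mset e1 (add_mset e2 R)"
        using M F1 F2 by (simp add: R_def)
      have "e1 \<in># ?F" "e2 \<in># ?F" unfolding F1 F2 by simp_all
      then have e: "e1 \<in> edges C" "e2 \<in> edges C" "?at e1" "?at e2"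
        using FE by (auto simp del: set_mset_filter) (auto split: if_splits)
      have RE: "set_mset R \<subseteq> edges C"
        using less.prems(1) MR by auto
      obtain c1 i p where e1: "i \<in> C" "i \<noteq> v" "Y e1 = cst c1 * y i v p"
        using edge_at[OF e(1,3)] .
      obtain c2 j q where e2: "j \<in> C" "j \<noteq> v" "Y e2 = cst c2 * y v j q"
        using edge_at'[OF e(2,4)] .
      have R: "(\<Prod>e\<in>#R. Y e) \<in> S" by (rule prod_mem[OF C RE])
      have n: "i < n" "j < n" "v < n" using C e1 e2 v by auto
      show ?thesis
      proof (cases "i = j")
        \<comment> \<open>Both edges join \<open>v\<close> to the same vertex; after one of them is
          reversed they are parallel.\<close>
        case True
        have "(\<Prod>e\<in>#M. Y e)
            = (- (cst c1 * cst c2 * cst (\<omega> powi q)) * (\<Prod>e\<in>#R. Y e)) * (y i v p * y i v (- q))"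
          using e1 e2 True y_skew[of v j q] by (simp add: MR algebra_simps)
        then show ?thesis
          using n e1 R by (simp only:) (intro ideal_mult parallel mult_mem uminus_mem cst_mem, auto)
      next
        case False
        \<comment> \<open>The triangle relation trades one of the two edges at \<open>v\<close> for
          the edge from \<open>i\<close> to \<open>j\<close>: fewer factors meet \<open>v\<close>,
          while their total number is kept.\<close>
        have IH: "(\<Prod>e\<in>#add_mset f (add_mset g R). Y e) \<in> J"
          if "f \<in> edges C" "g \<in> edges C" "\<not> ?at f" for f g
        proof (rule less.hyps)
          show "size (filter_mset ?at (add_mset f (add_mset g R))) < size ?F"
            using that e(3,4) by (simp add: MR)
        qed (use that RE less.prems(2) in \<open>auto simp: MR\<close>)
        let ?r = "y i v p * y v j q - y i j (p + q) * y v j q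
          - cst (\<omega> powi (- p)) * (y i v p * y i j (p + q))"
        have "(\<Prod>e\<in>#M. Y e) = (cst c1 * cst c2 * (\<Prod>e\<in>#R. Y e)) * ?r
          + (cst c1 * cst c2) * (\<Prod>e\<in>#add_mset (i, j, p + q) (add_mset (v, j, q) R). Y e)
          + (cst c1 * cst c2 * cst (\<omega> powi (- p)))
            * (\<Prod>e\<in>#add_mset (i, j, p + q) (add_mset (i, v, p) R). Y e)"
          using e1 e2 by (simp add: MR algebra_simps)
        also have "\<dots> \<in> J"
          using n e1 e2 v False R
          by (intro ideal_add ideal_mult triangle IH mult_mem cst_mem) (auto simp: edges_def)
        finally show ?thesis .
      qed
    qed
  qed
qed

section \<open>Flows as coefficient functions of linear forms\<close>

text \<open>The coefficient \<open>a i j k\<close> of \<open>y i j k\<close>: skewness makes \<open>a i j k * y i j k\<close> independent of the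
  orientation of the edge, so that \<open>lin a\<close> may sum over \<open>i < j\<close> only.\<close>

definition flow :: "(nat \<Rightarrow> nat \<Rightarrow> int \<Rightarrow> complex) \<Rightarrow> bool" where
  "flow a \<longleftrightarrow> (\<forall>i j k. a i j (k mod int m) = a i j k)
     \<and> (\<forall>i j k. a j i (- k) = - (\<omega> powi k) * a i j k)
     \<and> (\<forall>i j k. a i j k \<noteq> 0 \<longrightarrow> i < n \<and> j < n \<and> i \<noteq> j)"

definition upper :: "(nat \<times> nat \<times> int) set" where
  "upper = {(i, j, k). i < j \<and> j < n \<and> 0 \<le> k \<and> k < int m}"

definition lin :: "(nat \<Rightarrow> nat \<Rightarrow> int \<Rightarrow> complex) \<Rightarrow> 'r" where
  "lin a = (\<Sum>(i, j, k)\<in>upper. cst (a i j k) * y i j k)"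

definition supp :: "(nat \<Rightarrow> nat \<Rightarrow> int \<Rightarrow> complex) \<Rightarrow> (nat \<times> nat \<times> int) set" where
  "supp a = {(i, j, k). (i, j, k) \<in> upper \<and> a i j k \<noteq> 0}"

text \<open>Neighbours are paired with labels, so that the cardinality is the degree in the
  multigraph.\<close>

definition nbrs :: "(nat \<Rightarrow> nat \<Rightarrow> int \<Rightarrow> complex) \<Rightarrow> nat \<Rightarrow> (nat \<times> int) set" where
  "nbrs a i = {(j, k). j < n \<and> 0 \<le> k \<and> k < int m \<and> a i j k \<noteq> 0}"

text \<open>Edges entering \<open>i\<close> are counted through their skew coefficients. For a
  vector of K this is the coordinate at \<open>h_i\<close>.\<close>

definition net :: "(nat \<Rightarrow> nat \<Rightarrow> int \<Rightarrow> complex) \<Rightarrow> nat \<Rightarrow> complex" where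
  "net a i = (\<Sum>j<n. \<Sum>k\<in>{0..<int m}. a i j k)"

definition sources :: "(nat \<Rightarrow> nat \<Rightarrow> int \<Rightarrow> complex) \<Rightarrow> nat set" where
  "sources a = {i. i < n \<and> net a i \<noteq> 0}"

text \<open>The coefficient function of the single edge \<open>y i j k\<close>: besides the entry 1
  it has the entry that skewness forces on the reversed edge.\<close>

definition unit_flow :: "nat \<Rightarrow> nat \<Rightarrow> int \<Rightarrow> nat \<Rightarrow> nat \<Rightarrow> int \<Rightarrow> complex" where
  "unit_flow i j k i' j' k' =
     (if (i', j') = (i, j) then if k' mod int m = k mod int m then 1 else 0
      else if (i', j') = (j, i) then if k' mod int m = (- k) mod int m then - (\<omega> powi k) else 0
      else 0)"

definition comb :: "complex \<Rightarrow> (nat \<Rightarrow> nat \<Rightarrow> int \<Rightarrow> complex) \<Rightarrow> (nat \<Rightarrow> nat \<Rightarrow> int \<Rightarrow> complex)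
    \<Rightarrow> nat \<Rightarrow> nat \<Rightarrow> int \<Rightarrow> complex" where
  "comb c a b i j k = a i j k + c * b i j k"

lemma finite_upper: "finite upper"
proof (rule finite_subset)
  show "upper \<subseteq> {..<n} \<times> {..<n} \<times> {0..<int m}" by (auto simp: upper_def)
qed auto

lemma finite_supp: "finite (supp a)"
  by (rule finite_subset[OF _ finite_upper]) (auto simp: supp_def)

lemma finite_nbrs: "finite (nbrs a i)"
  by (rule finite_subset[of _ "{..<n} \<times> {0..<int m}"]) (auto simp: nbrs_def)

lemma flow_mod: "flow a \<Longrightarrow> a i j (k mod int m) = a i j k"
  and flow_skew: "flow a \<Longrightarrow> a j i (- k) = - (\<omega> powi k) * a i j k"
  and flow_bound: "flow a \<Longrightarrow> a i j k \<noteq> 0 \<Longrightarrow> i < n \<and> j < n \<and> i \<noteq> j"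
  unfolding flow_def by blast+

lemma flow_skew_eq_0: "flow a \<Longrightarrow> a j i (- k) = 0 \<longleftrightarrow> a i j k = 0"
  using flow_skew[of a j i k] omega_nz by simp

lemma lin_comb: "lin (comb c a b) = lin a + cst c * lin b"
  by (simp add: lin_def comb_def cst_add cst_mult sum_distrib_left algebra_simps case_prod_unfold
      flip: sum.distrib)

lemma net_comb: "net (comb c a b) i = net a i + c * net b i"
  by (simp add: net_def comb_def sum_distrib_left sum.distrib)

lemma flow_comb:
  assumes "flow a" "flow b"
  shows "flow (comb c a b)"
  unfolding flow_def
proof (intro conjI allI)
  fix i j k
  show "comb c a b i j (k mod int m) = comb c a b i j k"
    by (simp add: comb_def flow_mod[OF assms(1)] flow_mod[OF assms(2)])
  show "comb c a b j i (- k) = - (\<omega> powi k) * comb c a b i j k"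
    by (simp add: comb_def flow_skew[OF assms(1), of j i k] flow_skew[OF assms(2), of j i k] algebra_simps)
  show "comb c a b i j k \<noteq> 0 \<longrightarrow> i < n \<and> j < n \<and> i \<noteq> j"
    using flow_bound[OF assms(1), of i j k] flow_bound[OF assms(2), of i j k]
    by (cases "a i j k = 0") (auto simp: comb_def)
qed

lemma unit_flow_flow:
  assumes "i < n" "j < n" "i \<noteq> j"
  shows "flow (unit_flow i j k)"
  unfolding flow_def
proof (intro conjI allI)
  fix i' j' k'
  show "unit_flow i j k i' j' (k' mod int m) = unit_flow i j k i' j' k'"
    by (simp add: unit_flow_def)
  show "unit_flow i j k i' j' k' \<noteq> 0 \<longrightarrow> i' < n \<and> j' < n \<and> i' \<noteq> j'"
    using assms by (cases "(i', j') \<in> {(i, j), (j, i)}") (auto simp: unit_flow_def)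
  have eq: "(- k') mod int m = l mod int m \<longleftrightarrow> k' mod int m = (- l) mod int m" for l
    using mod_minus_cong[of "- k'" "int m" l] mod_minus_cong[of k' "int m" "- l"] by auto
  have w: "\<omega> powi x = \<omega> powi z" if "x mod int m = z mod int m" for x z
    using that by (metis powi_mod)
  consider "i' = i" "j' = j" | "i' = j" "j' = i" | "(i', j') \<notin> {(i, j), (j, i)}" by auto
  then show "unit_flow i j k j' i' (- k') = - (\<omega> powi k') * unit_flow i j k i' j' k'"
  proof cases
    case 1
    then show ?thesis
      using assms w[of k' k] eq[of "- k"] by (simp add: unit_flow_def)
  next
    case 2
    have "\<omega> powi k' * \<omega> powi k = 1" if "k' mod int m = (- k) mod int m"
      using w[OF that] powi_add[of "- k" k] by simp
    then show ?thesis
      using 2 assms eq[of k] by (simp add: unit_flow_def)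
  next
    case 3
    then have "(i', j') \<noteq> (i, j)" "(i', j') \<noteq> (j, i)" "(j', i') \<noteq> (i, j)" "(j', i') \<noteq> (j, i)" by auto
    then show ?thesis by (simp only: unit_flow_def if_False mult_zero_right)
  qed
qed

text \<open>\<open>lin\<close> sees an edge only with increasing ends. For \<open>j < i\<close> it
  meets the skew entry of \<open>unit_flow\<close>, and skewness of \<open>y\<close> turns the
  result back into \<open>y i j k\<close>.\<close>

lemma lin_unit_flow:
  assumes "i < n" "j < n" "i \<noteq> j"
  shows "lin (unit_flow i j k) = y i j k"
proof -
  have *: "lin (unit_flow i j k) = cst c * Y e"
    if "e \<in> upper" "\<And>a b l. (a, b, l) \<in> upper \<Longrightarrow> unit_flow i j k a b l = (if (a, b, l) = e then c else 0)" for e c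
  proof -
    have "lin (unit_flow i j k) = (\<Sum>f\<in>upper. if f = e then cst c * Y e else 0)"
      unfolding lin_def
    proof (intro sum.cong refl, clarify)
      fix a b l assume "(a, b, l) \<in> upper"
      then show "cst (unit_flow i j k a b l) * y a b l = (if (a, b, l) = e then cst c * Y e else 0)"
        by (subst that(2)) (auto simp: cst_0)
    qed
    then show ?thesis using that(1) finite_upper by simp
  qed
  show ?thesis
  proof (cases "i < j")
    case True
    have "lin (unit_flow i j k) = cst 1 * Y (i, j, k mod int m)"
      by (rule *) (use True assms m_pos in \<open>auto simp: upper_def unit_flow_def\<close>)
    then show ?thesis by (simp add: cst_1 y_mod)
  next
    case False
    have "lin (unit_flow i j k) = cst (- (\<omega> powi k)) * Y (j, i, (- k) mod int m)"
      by (rule *) (use False assms m_pos in \<open>auto simp: upper_def unit_flow_def\<close>)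
    then show ?thesis
      using y_skew[of i j k] assms(3) by (simp add: cst_uminus y_mod)
  qed
qed

lemma net_unit_flow:
  assumes "i < n" "j < n" "i \<noteq> j"
  shows "net (unit_flow i j k) v = (if v = i then 1 else if v = j then - (\<omega> powi k) else 0)"
proof -
  have *: "(\<Sum>j'<n. \<Sum>k'\<in>{0..<int m}. if j' = a \<and> k' = b mod int m then c else 0) = c"
    if "a < n" for a b and c :: complex
  proof -
    have "(\<Sum>j'<n. \<Sum>k'\<in>{0..<int m}. if j' = a \<and> k' = b mod int m then c else 0)
        = (\<Sum>j'<n. if j' = a then (\<Sum>k'\<in>{0..<int m}. if k' = b mod int m then c else 0) else 0)"
      by (intro sum.cong refl) auto
    then show ?thesis using that m_pos by simp
  qed
  have "net (unit_flow i j k) v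
      = (\<Sum>j'<n. \<Sum>k'\<in>{0..<int m}. if v = i then (if j' = j \<and> k' = k mod int m then 1 else 0)
          else if v = j then (if j' = i \<and> k' = (- k) mod int m then - (\<omega> powi k) else 0) else 0)"
    unfolding net_def using assms by (intro sum.cong refl) (auto simp: unit_flow_def)
  then show ?thesis
    using *[of j k 1] *[of i "- k" "- (\<omega> powi k)"] assms by auto
qed

lemma net_eq_sum_nbrs: "net a i = (\<Sum>(j, k)\<in>nbrs a i. a i j k)"
proof -
  have "net a i = (\<Sum>(j, k)\<in>{..<n} \<times> {0..<int m}. a i j k)"
    by (simp add: net_def sum.cartesian_product)
  also have "\<dots> = (\<Sum>(j, k)\<in>nbrs a i. a i j k)"
    by (rule sum.mono_neutral_right) (auto simp: nbrs_def)
  finally show ?thesis .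
qed

lemma lin_mem: "lin a \<in> S"
  unfolding lin_def by (rule sum_mem) (auto simp: upper_def intro!: mult_mem cst_mem y_mem)

text \<open>Every monomial of the expanded power is a product of at least \<open>card C\<close>
  edges inside \<open>C\<close>, so \<open>prod_edges_vanish\<close> applies.\<close>

lemma lin_power_vanish:
  assumes "C \<subseteq> {..<n}" "C \<noteq> {}" and a: "flow a" "\<And>i j k. a i j k \<noteq> 0 \<Longrightarrow> i \<in> C"
    and "card C \<le> l"
  shows "lin a ^ l \<in> J"
proof -
  \<comment> \<open>Generalised for induction: \<open>M\<close> collects the edges already chosen,
    \<open>k\<close> counts the factors not yet expanded.\<close>
  have "(\<Prod>e\<in>#M. Y e) * lin a ^ k \<in> J"
    if "set_mset M \<subseteq> edges C" "card C \<le> size M + k" for M k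
    using that
  proof (induction k arbitrary: M)
    case 0
    then show ?case using prod_edges_vanish[of C M] assms by simp
  next
    case (Suc k)
    have "(\<Prod>e\<in>#M. Y e) * lin a ^ Suc k
        = (\<Sum>(i, j, l)\<in>upper. cst (a i j l) * ((\<Prod>e\<in>#add_mset (i, j, l) M. Y e) * lin a ^ k))"
      unfolding power_Suc by (subst (1) lin_def)
        (simp add: sum_distrib_left sum_distrib_right case_prod_unfold mult_ac)
    also have "\<dots> \<in> J"
    proof (intro ideal_sum, clarify)
      fix i j l assume "(i, j, l) \<in> upper"
      show "cst (a i j l) * ((\<Prod>e\<in>#add_mset (i, j, l) M. Y e) * lin a ^ k) \<in> J"
      proof (cases "a i j l = 0")
        case True
        then show ?thesis by (simp add: cst_0 ideal_zero)
      next
        case False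
        then have "i \<in> C" "j \<in> C" "i \<noteq> j"
          using a(2)[of i j l] a(2)[of j i "- l"] flow_skew_eq_0[OF a(1), of j i l]
            flow_bound[OF a(1), of i j l] by auto
        then show ?thesis
          using Suc.prems by (intro ideal_mult cst_mem Suc.IH) (auto simp: edges_def)
      qed
    qed
    finally show ?case .
  qed
  from this[of "{#}" l] show ?thesis using assms by simp
qed

section \<open>Triangles and balanced flows\<close>

lemma mem_nbrs:
  assumes "flow a"
  shows "(j, k mod int m) \<in> nbrs a i \<longleftrightarrow> a i j k \<noteq> 0"
  using assms m_pos flow_bound[OF assms, of i j k] by (auto simp: nbrs_def flow_mod[OF assms])

lemma mem_nbrs_sym:
  assumes "flow a" "(j, k) \<in> nbrs a i"
  shows "(i, (- k) mod int m) \<in> nbrs a j"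
  unfolding mem_nbrs[OF assms(1)] flow_skew_eq_0[OF assms(1)] using assms(2) by (simp add: nbrs_def)

lemma unit_flow_eq_0: "(i', j') \<notin> {(i, j), (j, i)} \<Longrightarrow> unit_flow i j k i' j' k' = 0"
proof -
  assume "(i', j') \<notin> {(i, j), (j, i)}"
  then have "(i', j') \<noteq> (i, j)" "(i', j') \<noteq> (j, i)" by auto
  then show ?thesis by (simp only: unit_flow_def if_False)
qed

lemma unit_flow_fwd: "unit_flow i j k i j k' = (if k' mod int m = k mod int m then 1 else 0)"
  by (simp add: unit_flow_def)

lemma unit_flow_bwd: "i \<noteq> j \<Longrightarrow>
    unit_flow i j k j i k' = (if k' mod int m = (- k) mod int m then - (\<omega> powi k) else 0)"
  by (simp add: unit_flow_def)

definition tri_flow :: "nat \<Rightarrow> nat \<Rightarrow> nat \<Rightarrow> int \<Rightarrow> int \<Rightarrow> nat \<Rightarrow> nat \<Rightarrow> int \<Rightarrow> complex" where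
  "tri_flow i v j p q =
     comb (- 1) (comb (\<omega> powi p) (unit_flow i v p) (unit_flow v j q)) (unit_flow i j (p + q))"

text \<open>Balance at \<open>j\<close> amounts to
  \<open>\<omega> powi p * \<omega> powi q = \<omega> powi (p + q)\<close>, which is why the closing
  edge carries the label \<open>p + q\<close>.\<close>

lemma tri_flow:
  assumes "i < n" "v < n" "j < n" "distinct [i, v, j]"
  shows "flow (tri_flow i v j p q)" "lin (tri_flow i v j p q) = tri i v j p q"
    "net (tri_flow i v j p q) x = 0"
  using assms
  by (auto simp: tri_flow_def flow_comb unit_flow_flow lin_comb lin_unit_flow tri_def cst_uminus cst_1
      net_comb net_unit_flow powi_add)

lemma cst_mult_square: "p\<^sup>2 \<in> J \<Longrightarrow> (cst c * p)\<^sup>2 \<in> J"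
  by (simp add: power_mult_distrib ideal_mult power_mem cst_mem)

text \<open>A vertex \<open>v\<close> of degree two is removed by subtracting a multiple of the triangle through \<open>v\<close> and
  its two neighbours, whose square lies in \<open>J\<close>. The neighbours are distinct because a flow on two
  parallel edges with different labels cannot be balanced at both ends.\<close>

lemma balanced_power:
  assumes "flow a" "C \<subseteq> {..<n}" "2 \<le> card C" "\<And>i j k. a i j k \<noteq> 0 \<Longrightarrow> i \<in> C"
    and "\<And>i. net a i = 0" "\<And>i. card (nbrs a i) \<le> 2"
  shows "lin a ^ (card C - 1) \<in> J"
  using assms
proof (induction "card C" arbitrary: C a rule: less_induct)
  case (less C a)
  note a = \<open>flow a\<close> and C = \<open>C \<subseteq> {..<n}\<close>
  have fin: "finite C" by (rule finite_subset[OF C]) simp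
  obtain v where v: "v \<in> C" using less.prems(3) by fastforce
  have sz: "card (C - {v}) = card C - 1" "card (C - {v}) < card C"
    using v fin less.prems(3) by (auto simp: card_Diff_singleton)
  consider "card (nbrs a v) = 0" | "card (nbrs a v) = 1" | "card (nbrs a v) = 2"
    using less.prems(6)[of v] by linarith
  then show ?case
  proof cases
    case 1
    then have v0: "a v j k = 0" for j k
      using finite_nbrs[of a v] mem_nbrs[OF a, of j k v] by auto
    have v0': "a j v k = 0" for j k
      using v0[of j "- k"] flow_skew_eq_0[OF a, of j v "- k"] by simp
    have supp: "i \<in> C - {v}" if "a i j k \<noteq> 0" for i j k
      using that less.prems(4) v0 by auto
    show ?thesis
    proof (cases "card C = 2")
      \<comment> \<open>Only one vertex remains besides \<open>v\<close>, so there are no edges at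
        all and \<open>lin a = 0\<close>; the exponent is 1.\<close>
      case True
      then obtain w where w: "C - {v} = {w}"
        using sz by (metis One_nat_def card_1_singletonE diff_Suc_1 numeral_2_eq_2)
      have "a i j k = 0" for i j k
      proof (rule ccontr)
        assume ne: "a i j k \<noteq> 0"
        then have "a j i (- k) \<noteq> 0" using flow_skew_eq_0[OF a, of j i k] by simp
        then show False
          using ne supp[of i j k] supp[of j i "- k"] flow_bound[OF a ne] w by auto
      qed
      then have "lin a = 0" by (simp add: lin_def cst_0)
      then show ?thesis using True by (simp add: ideal_zero)
    next
      case False
      have "lin a ^ (card (C - {v}) - 1) \<in> J"
      proof (rule less.hyps[OF sz(2) a _ _ _ less.prems(5,6)])
        show "C - {v} \<subseteq> {..<n}" using C by blast
        show "2 \<le> card (C - {v})" using sz False less.prems(3) by linarith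
      qed (rule supp)
      then show ?thesis
        by (rule ideal_power_mono[OF lin_mem]) (use sz in simp)
    qed
  next
    \<comment> \<open>A single edge at \<open>v\<close> would make its nonzero coefficient the net
      flow at \<open>v\<close>.\<close>
    case 2
    then obtain j k where "nbrs a v = {(j, k)}" by (metis card_1_singletonE surj_pair)
    then have "net a v = a v j k" "a v j k \<noteq> 0"
      by (auto simp: net_eq_sum_nbrs) (auto simp: nbrs_def)
    then show ?thesis using less.prems(5)[of v] by simp
  next
    case 3
    then obtain e f where "nbrs a v = {e, f}" "e \<noteq> f" by (meson card_2_iff)
    then obtain i p j q where nv: "nbrs a v = {(i, p), (j, q)}" and ne: "(i, p) \<noteq> (j, q)"
      by (metis surj_pair)
    define \<alpha> where "\<alpha> = a v i p"
    have ip: "(i, p) \<in> nbrs a v" and jq: "(j, q) \<in> nbrs a v" using nv by auto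
    have p: "p mod int m = p" and q: "q mod int m = q"
      using ip jq by (auto simp: nbrs_def)
    have \<alpha>: "\<alpha> \<noteq> 0" "i < n" "i \<noteq> v" "j < n" "j \<noteq> v" "a v j q \<noteq> 0" "v < n"
      using ip jq flow_bound[OF a, of v i p] flow_bound[OF a, of v j q] by (auto simp: \<alpha>_def nbrs_def)
    have "net a v = \<alpha> + a v j q"
      using nv ne by (simp add: net_eq_sum_nbrs \<alpha>_def)
    then have \<beta>: "a v j q = - \<alpha>"
      using less.prems(5)[of v] by (simp add: eq_neg_iff_add_eq_0 add.commute)
    \<comment> \<open>Otherwise the two edges at \<open>v\<close> are also all edges at
      \<open>i\<close>. Their coefficients are opposite at \<open>v\<close>, and balance at
      \<open>i\<close> then forces \<open>\<omega> powi p = \<omega> powi q\<close>, against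
      primitivity.\<close>
    have "i \<noteq> j"
    proof
      assume ij: "i = j"
      then have pq: "p \<noteq> q" using ne by auto
      have pq': "(- p) mod int m \<noteq> (- q) mod int m"
        using pq p q by (metis mod_minus_cong minus_minus)
      have "{(v, (- p) mod int m), (v, (- q) mod int m)} \<subseteq> nbrs a i"
        using mem_nbrs_sym[OF a ip] mem_nbrs_sym[OF a jq] ij by auto
      then have "nbrs a i = {(v, (- p) mod int m), (v, (- q) mod int m)}"
        using less.prems(6)[of i] pq' finite_nbrs[of a i]
        by (metis (no_types, lifting) card_2_iff card_seteq prod.inject)
      then have "net a i = a i v (- p) + a i v (- q)"
        using pq' by (simp add: net_eq_sum_nbrs flow_mod[OF a])
      also have "\<dots> = \<alpha> * (\<omega> powi q - \<omega> powi p)"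
        using \<beta>[folded ij] flow_skew[OF a, of i v p] flow_skew[OF a, of i v q]
        by (simp add: \<alpha>_def algebra_simps)
      finally have "\<omega> powi q = \<omega> powi p"
        using less.prems(5)[of i] \<alpha>(1) by simp
      then show False using primitive[of q p] pq unfolding p q by simp
    qed
    then have dist: "distinct [v, i, j]" using \<alpha> by auto
    \<comment> \<open>The closing label is \<open>p + (q - p) = q\<close>, so
      \<open>\<alpha>\<close> times this triangle agrees with \<open>a\<close> on both edges at
      \<open>v\<close>.\<close>
    define t where "t = tri_flow v i j p (q - p)"
    define b where "b = comb (- \<alpha>) a t"
    have t: "flow t" "lin t = tri v i j p (q - p)" "\<And>x. net t x = 0"
      unfolding t_def using tri_flow \<alpha> dist by auto
    have b: "flow b" unfolding b_def by (rule flow_comb[OF a t(1)])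
    have b_eq: "b x y l = a x y l - \<alpha> * t x y l" for x y l
      by (simp add: b_def comb_def)
    have ij: "i \<in> C" "j \<in> C"
      using ip jq \<alpha> less.prems(4)[of i v "- p"] less.prems(4)[of j v "- q"]
        flow_skew_eq_0[OF a, of i v p] flow_skew_eq_0[OF a, of j v q] \<beta> by (auto simp: \<alpha>_def)
    have bv: "b v x l = 0" for x l
    proof -
      have tv: "t v x l = (if x = i \<and> l mod int m = p then 1 else 0)
          - (if x = j \<and> l mod int m = q then 1 else 0)"
        using dist p q
        by (cases "x = i"; cases "x = j")
          (auto simp: t_def tri_flow_def comb_def unit_flow_eq_0 unit_flow_fwd)
      have "a v x l = (if x = i \<and> l mod int m = p then \<alpha> else 0)
          - (if x = j \<and> l mod int m = q then \<alpha> else 0)"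
      proof (cases "(x, l mod int m) \<in> nbrs a v")
        case True
        then have "(x, l mod int m) = (i, p) \<or> (x, l mod int m) = (j, q)" using nv by auto
        then show ?thesis
          using flow_mod[OF a, of v x l] \<beta> dist by (auto simp: \<alpha>_def)
      next
        case False
        then show ?thesis using mem_nbrs[OF a, of x l v] nv by auto
      qed
      then show ?thesis by (simp only: b_eq tv) (simp add: right_diff_distrib)
    qed
    have bv': "b x v l = 0" for x l
      using bv[of x "- l"] flow_skew_eq_0[OF b, of x v "- l"] by simp
    have t0: "t x y l = 0" if "(x, y) \<notin> {(i, j), (j, i)}" "x \<noteq> v" "y \<noteq> v" for x y l
      using that dist by (auto simp: t_def tri_flow_def comb_def unit_flow_eq_0)
    have t0': "t i j l = 0" if "l mod int m \<noteq> (q - p) mod int m" for l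
      using that dist by (simp add: t_def tri_flow_def comb_def unit_flow_eq_0 unit_flow_fwd)
    have t0'': "t j i l = 0" if "l mod int m \<noteq> (p - q) mod int m" for l
      using that dist by (simp add: t_def tri_flow_def comb_def unit_flow_eq_0 unit_flow_bwd)
    \<comment> \<open>A neighbour of \<open>v\<close> loses its edge to \<open>v\<close> and can
      gain only the edge to the other neighbour, so its degree does not grow.\<close>
    have sub: "nbrs b x \<subseteq> insert (z, r mod int m) (nbrs a x - {(v, s)})"
      if "\<And>y l. y \<noteq> v \<Longrightarrow> (y, l mod int m) \<noteq> (z, r mod int m) \<Longrightarrow> t x y l = 0" for x z r s
    proof
      fix e assume e: "e \<in> nbrs b x"
      obtain y l where el: "e = (y, l)" by (cases e)
      have l: "l mod int m = l" and ne: "b x y l \<noteq> 0"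
        using e el by (auto simp: nbrs_def)
      then have "y \<noteq> v" using bv' by auto
      show "e \<in> insert (z, r mod int m) (nbrs a x - {(v, s)})"
      proof (cases "e = (z, r mod int m)")
        case False
        then have "a x y l \<noteq> 0" using that[of y l] ne b_eq l el \<open>y \<noteq> v\<close> by auto
        then show ?thesis using e el \<open>y \<noteq> v\<close> by (auto simp: nbrs_def)
      qed simp
    qed
    have deg: "card (nbrs b x) \<le> 2" for x
    proof -
      have *: "card (nbrs b x) \<le> 2"
        if "nbrs b x \<subseteq> insert g (nbrs a x - {f})" "f \<in> nbrs a x" for f g
      proof -
        have "card (nbrs b x) \<le> card (insert g (nbrs a x - {f}))"
          using that finite_nbrs by (intro card_mono) auto
        also have "\<dots> \<le> Suc (card (nbrs a x - {f}))"
          by (metis card_insert_if finite_nbrs finite_Diff le_SucI order_refl)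
        also have "\<dots> = card (nbrs a x)"
          using that finite_nbrs by (metis card_Suc_Diff1)
        finally show ?thesis using less.prems(6)[of x] by simp
      qed
      consider "x = v" | "x = i" | "x = j" | "x \<notin> {v, i, j}" by auto
      then show ?thesis
      proof cases
        case 1
        then have "nbrs b x = {}" using bv by (auto simp: nbrs_def)
        then show ?thesis by simp
      next
        case 2
        have "nbrs b i \<subseteq> insert (j, (q - p) mod int m) (nbrs a i - {(v, (- p) mod int m)})"
          by (rule sub) (use t0[of i] t0' dist in fastforce)
        then show ?thesis
          using * 2 mem_nbrs_sym[OF a ip] by blast
      next
        case 3
        have "nbrs b j \<subseteq> insert (i, (p - q) mod int m) (nbrs a j - {(v, (- q) mod int m)})"
          by (rule sub) (use t0[of j] t0'' dist in fastforce)
        then show ?thesis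
          using * 3 mem_nbrs_sym[OF a jq] by blast
      next
        case 4
        have "nbrs b x \<subseteq> nbrs a x"
        proof clarify
          fix y l assume *: "(y, l) \<in> nbrs b x"
          then have "y \<noteq> v" using bv'[of x l] by (auto simp: nbrs_def)
          then have "t x y l = 0" using t0[of x y l] 4 by auto
          then show "(y, l) \<in> nbrs a x" using * b_eq[of x y l] by (auto simp: nbrs_def)
        qed
        then show ?thesis
          using order_trans[OF card_mono[OF finite_nbrs] less.prems(6)] by blast
      qed
    qed
    have supp: "x \<in> C - {v}" if "b x y l \<noteq> 0" for x y l
    proof -
      have "x \<noteq> v" "y \<noteq> v" using that bv bv' by auto
      then show ?thesis
        using that t0[of x y l] less.prems(4)[of x y l] ij b_eq[of x y l] by (cases "x \<in> {i, j}") auto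
    qed
    have "{i, j} \<subseteq> C - {v}" using ij dist by auto
    then have card2: "2 \<le> card (C - {v})"
      using card_mono[of "C - {v}" "{i, j}"] fin \<open>i \<noteq> j\<close> by simp
    have "lin b ^ (card (C - {v}) - 1) \<in> J"
    proof (rule less.hyps[OF sz(2) b _ card2 _ _ deg])
      show "C - {v} \<subseteq> {..<n}" using C by blast
      show "net b x = 0" for x
        by (simp add: b_def net_comb t(3) less.prems(5))
    qed (rule supp)
    moreover have "(cst \<alpha> * tri v i j p (q - p))\<^sup>2 \<in> J"
      by (intro cst_mult_square tri_square) (use \<alpha> dist in auto)
    moreover have "cst \<alpha> * tri v i j p (q - p) \<in> S"
      using lin_mem[of t] t(2) by (simp add: mult_mem cst_mem)
    \<comment> \<open>Restoring the triangle costs one in the exponent, which the removed vertex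
      pays for.\<close>
    ultimately have "(lin b + cst \<alpha> * tri v i j p (q - p)) ^ Suc (card (C - {v}) - 1) \<in> J"
      by (intro ideal_power_add_square_zero[OF lin_mem])
    moreover have "lin b + cst \<alpha> * tri v i j p (q - p) = lin a"
      by (simp add: b_def lin_comb t(2) cst_uminus)
    moreover have "Suc (card (C - {v}) - 1) = card C - 1"
      using sz card2 by linarith
    ultimately show ?thesis by (simp only:)
  qed
qed

section \<open>Counting edges, and powers of arbitrary flows\<close>

lemma sum_card_nbrs:
  assumes "flow a"
  shows "(\<Sum>i<n. card (nbrs a i)) = 2 * card (supp a)"
proof -
  let ?D = "Sigma {..<n} (nbrs a)"
  let ?r = "\<lambda>(i, j, k). (j, i, (- k) mod int m)"
  have fin: "finite ?D" by (auto simp: finite_nbrs)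
  have ne: "i \<noteq> j" if "(i, j, k) \<in> ?D" for i j k
    using that flow_bound[OF assms, of i j k] by (auto simp: nbrs_def)
  have r: "?r e \<in> ?D" "?r (?r e) = e" if "e \<in> ?D" for e
  proof -
    obtain i j k where e: "e = (i, j, k)" by (cases e)
    have k: "k mod int m = k" and ij: "i < n" "j < n" and n: "(j, k) \<in> nbrs a i"
      using that e by (auto simp: nbrs_def)
    show "?r e \<in> ?D" using mem_nbrs_sym[OF assms n] ij e by simp
    show "?r (?r e) = e" using k e by (simp add: mod_minus_eq)
  qed
  have up: "{e \<in> ?D. fst e < fst (snd e)} = supp a"
    by (auto simp: supp_def upper_def nbrs_def)
  \<comment> \<open>Reversal is an involution that exchanges the two orientations, so each class has
    as many elements as \<open>supp a\<close>.\<close>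
  have "card {e \<in> ?D. fst (snd e) < fst e} = card {e \<in> ?D. fst e < fst (snd e)}"
  proof (rule bij_betw_same_card[of ?r], rule bij_betw_byWitness[where f' = ?r])
    show "?r ` {e \<in> ?D. fst (snd e) < fst e} \<subseteq> {e \<in> ?D. fst e < fst (snd e)}"
      using r(1) by force
    show "?r ` {e \<in> ?D. fst e < fst (snd e)} \<subseteq> {e \<in> ?D. fst (snd e) < fst e}"
      using r(1) by force
  qed (use r(2) in blast)+
  moreover have "?D = {e \<in> ?D. fst e < fst (snd e)} \<union> {e \<in> ?D. fst (snd e) < fst e}"
    using ne by (auto simp: nat_neq_iff) (metis nat_neq_iff)
  then have "card ?D = card {e \<in> ?D. fst e < fst (snd e)} + card {e \<in> ?D. fst (snd e) < fst e}"
    using fin by (metis (no_types, lifting) card_Un_disjoint finite_Un disjoint_iff mem_Collect_eq order_less_asym)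
  ultimately show ?thesis
    using up by (simp add: finite_nbrs)
qed

text \<open>The subtraction clears the edge in both orientations, but \<open>supp\<close> records it
  only with increasing ends; the two cases determine that representative.\<close>

lemma supp_remove_edge:
  assumes a: "flow a" and "v < n" "j < n" "v \<noteq> j" and ne: "a v j k \<noteq> 0"
  shows "card (supp a) = Suc (card (supp (comb (- a v j k) a (unit_flow v j k))))"
proof -
  let ?b = "comb (- a v j k) a (unit_flow v j k)"
  have *: "card (supp a) = Suc (card (supp ?b))"
    if e: "e \<in> supp a" and eq: "\<And>x y l. (x, y, l) \<in> upper \<Longrightarrow> ?b x y l = (if (x, y, l) = e then 0 else a x y l)" for e
  proof -
    have "supp ?b = supp a - {e}"
      by (auto simp: supp_def eq split: if_splits)
    then show ?thesis
      using e by (metis card_Suc_Diff1 finite_supp)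
  qed
  show ?thesis
  proof (cases "v < j")
    case True
    show ?thesis
    proof (rule *)
      show "(v, j, k mod int m) \<in> supp a"
        using True assms m_pos by (simp add: supp_def upper_def flow_mod[OF a])
      show "?b x y l = (if (x, y, l) = (v, j, k mod int m) then 0 else a x y l)"
        if "(x, y, l) \<in> upper" for x y l
      proof (cases "(x, y) = (v, j)")
        case True
        then show ?thesis
          using that assms flow_mod[OF a, of v j k] by (auto simp: comb_def unit_flow_fwd upper_def)
      next
        case False
        then have "unit_flow v j k x y l = 0"
          using that True by (intro unit_flow_eq_0) (auto simp: upper_def)
        then show ?thesis using False by (auto simp: comb_def)
      qed
    qed
  next
    case False
    show ?thesis
    proof (rule *)
      show "(j, v, (- k) mod int m) \<in> supp a"
        using False assms m_pos by (simp add: supp_def upper_def flow_mod[OF a] flow_skew_eq_0[OF a])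
      show "?b x y l = (if (x, y, l) = (j, v, (- k) mod int m) then 0 else a x y l)"
        if "(x, y, l) \<in> upper" for x y l
      proof (cases "(x, y) = (j, v)")
        case True
        then show ?thesis
          using that assms flow_mod[OF a, of j v "- k"] flow_skew[OF a, of j v k]
          by (auto simp: comb_def unit_flow_bwd upper_def)
      next
        case ne: False
        then have "unit_flow v j k x y l = 0"
          using that False by (intro unit_flow_eq_0) (auto simp: upper_def)
        then show ?thesis using ne by (auto simp: comb_def)
      qed
    qed
  qed
qed

lemma supp_nonempty:
  assumes a: "flow a" and ne: "a i j k \<noteq> 0"
  shows "0 < card (supp a)"
  using supp_remove_edge[OF a _ _ _ ne] flow_bound[OF a ne] by simp

text \<open>An edge \<open>e\<close> at a vertex of degree one is removed at the cost of one in the exponent, since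
  the square of \<open>Y e\<close> lies in \<open>J\<close>. When all degrees are at least two, there are at least as many
  edges as vertices, so the degree bound of \<open>lin_power_vanish\<close> applies, except when the flow
  is balanced with all degrees equal to two.\<close>

lemma lin_power:
  assumes "flow a" "a r s l \<noteq> 0"
  shows "lin a ^ (card (supp a) + card (sources a) - 1) \<in> J"
  using assms
proof (induction "card (supp a)" arbitrary: a r s l rule: less_induct)
  case (less a)
  note a = \<open>flow a\<close>
  let ?N = "card (supp a) + card (sources a) - 1"
  have fins: "finite (sources b)" for b by (auto simp: sources_def)
  show ?case
  proof (cases "\<exists>v. card (nbrs a v) = 1")
    case True
    then obtain v j k where nv: "nbrs a v = {(j, k)}"
      by (metis card_1_singletonE surj_pair)
    have jk: "(j, k) \<in> nbrs a v" using nv by simp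
    define \<alpha> where "\<alpha> = a v j k"
    have \<alpha>: "\<alpha> \<noteq> 0" using jk by (simp add: \<alpha>_def nbrs_def)
    then have vj: "v < n" "j < n" "v \<noteq> j" using flow_bound[OF a] by (auto simp: \<alpha>_def)
    define b where "b = comb (- \<alpha>) a (unit_flow v j k)"
    have b: "flow b" unfolding b_def by (intro flow_comb a unit_flow_flow vj)
    have supp: "card (supp a) = Suc (card (supp b))"
      using supp_remove_edge[OF a vj] \<alpha> by (simp add: b_def \<alpha>_def)
    have lin: "lin a = lin b + cst \<alpha> * y v j k"
      by (simp add: b_def lin_comb lin_unit_flow[OF vj] cst_uminus)
    have net_b: "net b w = net a w - \<alpha> * (if w = v then 1 else if w = j then - (\<omega> powi k) else 0)" for w
      unfolding b_def net_comb net_unit_flow[OF vj] by simp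
    have net_v: "net a v = \<alpha>" by (simp add: net_eq_sum_nbrs nv \<alpha>_def)
    have sq: "(cst \<alpha> * y v j k)\<^sup>2 \<in> J"
      using parallel[OF vj] by (intro cst_mult_square) (simp add: power2_eq_square)
    have mem: "cst \<alpha> * y v j k \<in> S"
      using vj by (intro mult_mem cst_mem y_mem)
    show ?thesis
    proof (cases "\<forall>i j k. b i j k = 0")
      \<comment> \<open>The flow is a single edge. Both its ends are sources, so the exponent is at
        least 2 and the square of the edge suffices.\<close>
      case True
      then have "lin b = 0" "net b w = 0" for w
        by (simp_all add: lin_def net_def cst_0)
      then have la: "lin a = cst \<alpha> * y v j k" and "{v, j} \<subseteq> sources a"
        using lin net_b[of j] net_v \<alpha> vj omega_nz by (auto simp: sources_def)
      then have "2 \<le> card (sources a)"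
        using card_mono[OF fins[of a], of "{v, j}"] vj by simp
      then have "2 \<le> ?N" using supp by simp
      then show ?thesis
        unfolding la by (rule ideal_power_mono[OF mem sq])
    next
      case False
      then obtain i' j' k' where ne: "b i' j' k' \<noteq> 0" by blast
      let ?M = "card (supp b) + card (sources b) - 1"
      have "lin b ^ ?M \<in> J"
        by (rule less.hyps[OF _ b ne]) (use supp in simp)
      then have M: "lin a ^ Suc ?M \<in> J"
        unfolding lin using sq mem by (intro ideal_power_add_square_zero[OF lin_mem])
      \<comment> \<open>The vertex \<open>v\<close> stops being a source and at most
        \<open>j\<close> becomes one: the number of sources does not grow while one edge
        disappears.\<close>
      have "sources b \<subseteq> insert j (sources a - {v})"
        using net_b net_v vj by (auto simp: sources_def split: if_splits)
      then have "card (sources b) \<le> card (insert j (sources a - {v}))"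
        using fins by (intro card_mono) auto
      also have "\<dots> \<le> Suc (card (sources a - {v}))"
        by (simp add: card_insert_if fins)
      also have "\<dots> = card (sources a)"
        using fins net_v \<alpha> vj by (intro card_Suc_Diff1) (auto simp: sources_def)
      finally have "Suc ?M \<le> ?N"
        using supp supp_nonempty[OF b ne] by linarith
      then show ?thesis
        by (rule ideal_power_mono[OF lin_mem M])
    qed
  next
    case False
    define V where "V = {i. i < n \<and> nbrs a i \<noteq> {}}"
    have V: "V \<subseteq> {..<n}" "finite V" by (auto simp: V_def)
    have aV: "i \<in> V" if "a i j k \<noteq> 0" for i j k
      using that mem_nbrs[OF a, of j k i] flow_bound[OF a that] by (auto simp: V_def)
    have deg: "2 \<le> card (nbrs a i)" if "i \<in> V" for i
    proof -
      have "card (nbrs a i) \<noteq> 0" using that finite_nbrs by (auto simp: V_def)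
      then show ?thesis using False by (metis One_nat_def Suc_1 Suc_leI le_neq_implies_less le_zero_eq not_less_eq_eq)
    qed
    have sum: "(\<Sum>i\<in>V. card (nbrs a i)) = 2 * card (supp a)"
      unfolding sum_card_nbrs[OF a, symmetric] by (rule sum.mono_neutral_left) (auto simp: V_def)
    have "(\<Sum>i\<in>V. 2) \<le> (\<Sum>i\<in>V. card (nbrs a i))"
      using deg by (rule sum_mono)
    then have le: "card V \<le> card (supp a)" using sum by simp
    have rV: "r \<in> V" using aV less.prems(2) .
    have "a s r (- l) \<noteq> 0" using less.prems(2) flow_skew_eq_0[OF a, of s r l] by simp
    then have sV: "s \<in> V" by (rule aV)
    show ?thesis
    proof (cases "card V \<le> ?N")
      case True
      then show ?thesis
        using V rV aV by (intro lin_power_vanish[of V]) (auto simp: a)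
    next
      case large: False
      \<comment> \<open>With \<open>card V\<close> at most the number of edges and \<open>?N\<close>
        below \<open>card V\<close>, there is no room for a source or for a surplus edge.\<close>
      then have eq: "card V = card (supp a)" "card (sources a) = 0"
        using le supp_nonempty[OF a less.prems(2)] by linarith+
      have net: "net a i = 0" for i
      proof (cases "i < n")
        case True
        then show ?thesis using eq(2) fins by (auto simp: sources_def)
      next
        case False
        then have "a i j k = 0" for j k using flow_bound[OF a, of i j k] by auto
        then show ?thesis by (simp add: net_def)
      qed
      have "card (nbrs a i) \<le> 2" if "i \<in> V" for i
      proof (rule ccontr)
        assume "\<not> card (nbrs a i) \<le> 2"
        then have "(\<Sum>i\<in>V. 2) < (\<Sum>i\<in>V. card (nbrs a i))"
          using deg that V by (intro sum_strict_mono_ex1) (auto intro!: bexI[of _ i])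
        then show False using sum eq by simp
      qed
      moreover have "nbrs a i = {}" if "i \<notin> V" for i
        using that flow_bound[OF a] by (auto simp: V_def nbrs_def)
      ultimately have deg2: "card (nbrs a i) \<le> 2" for i
        by (cases "i \<in> V") auto
      have "card {r, s} \<le> card V"
        using rV sV V by (intro card_mono) auto
      then have "2 \<le> card V" using flow_bound[OF a less.prems(2)] by auto
      then have "lin a ^ (card V - 1) \<in> J"
        by (rule balanced_power[OF a V(1) _ _ net deg2]) (rule aV)
      then show ?thesis using eq by simp
    qed
  qed
qed

end

section \<open>Symmetric algebras\<close>

lemma Const_0: "Const 0 = 0" and Const_1: "Const 1 = 1"
  by (simp_all add: Const_def)

lemma Const_add: "Const (a + b) = Const a + Const b"
  by (simp add: Const_def single_add)

lemma Const_mult: "Const (a * b) = Const a * Const b"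
  by (simp add: Const_def mult_single)

lemma Const_uminus: "Const (- a) = - Const a"
  by (simp add: Const_def single_uminus)

lemma lookup_cvec_scale: "Poly_Mapping.lookup (cvec_scale c v) x = c * Poly_Mapping.lookup v x"
  by (simp add: cvec_scale_def Poly_Mapping.map.rep_eq when_def)

text \<open>Any finite set containing the keys may index the sum; this puts several vectors on a
  common index set and makes linearity a termwise matter.\<close>

lemma linear_form_superset:
  assumes "finite A" "Poly_Mapping.keys v \<subseteq> A"
  shows "linear_form v = (\<Sum>x\<in>A. Const (Poly_Mapping.lookup v x) * Var x)"
  unfolding linear_form_def
  by (rule sum.mono_neutral_left) (use assms in \<open>auto simp: in_keys_iff Const_0\<close>)

lemma linear_form_add: "linear_form (u + v) = linear_form u + linear_form v"
proof -
  let ?A = "Poly_Mapping.keys u \<union> Poly_Mapping.keys v"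
  have "linear_form w = (\<Sum>x\<in>?A. Const (Poly_Mapping.lookup w x) * Var x)"
    if "Poly_Mapping.keys w \<subseteq> ?A" for w
    using that by (intro linear_form_superset) auto
  then show ?thesis
    using keys_add[of u v] by (simp add: lookup_add Const_add algebra_simps sum.distrib)
qed

lemma linear_form_scale: "linear_form (cvec_scale c v) = Const c * linear_form v"
proof -
  have "Poly_Mapping.keys (cvec_scale c v) \<subseteq> Poly_Mapping.keys v"
    by (auto simp: in_keys_iff lookup_cvec_scale)
  then show ?thesis
    by (simp add: linear_form_superset[of "Poly_Mapping.keys v"] lookup_cvec_scale Const_mult
        sum_distrib_left mult.assoc)
qed

lemma linear_form_0: "linear_form 0 = 0"
  by (simp add: linear_form_def)

lemma linear_form_uminus: "linear_form (- v) = - linear_form v"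
  using linear_form_add[of v "- v"] by (simp add: linear_form_0 eq_neg_iff_add_eq_0 add.commute)

lemma linear_form_diff: "linear_form (u - v) = linear_form u - linear_form v"
  using linear_form_add[of u "- v"] by (simp add: linear_form_uminus)

lemma linear_form_sum: "linear_form (sum f A) = (\<Sum>x\<in>A. linear_form (f x))"
  by (induction A rule: infinite_finite_induct) (auto simp: linear_form_0 linear_form_add)

lemma linear_form_hvec: "linear_form (hvec g) = Var g"
  by (simp add: linear_form_def hvec_def Const_1)

section \<open>The algebra endomorphism induced by a linear map\<close>

lemma poly_mapping_eq_sum_single:
  "p = (\<Sum>t\<in>Poly_Mapping.keys p. Poly_Mapping.single t (Poly_Mapping.lookup p t))"
  by (rule poly_mapping_eqI) (auto simp: lookup_sum lookup_single when_def in_keys_iff)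

definition monom_map :: "('x \<Rightarrow> 'x cvec) \<Rightarrow> ('x \<Rightarrow>\<^sub>0 nat) \<Rightarrow> 'x cpoly" where
  "monom_map f t = (\<Prod>x\<in>Poly_Mapping.keys t. linear_form (f x) ^ Poly_Mapping.lookup t x)"

lemma monom_map_add: "monom_map f (s + t) = monom_map f s * monom_map f t"
proof -
  let ?A = "Poly_Mapping.keys s \<union> Poly_Mapping.keys t"
  have "monom_map f r = (\<Prod>x\<in>?A. linear_form (f x) ^ Poly_Mapping.lookup r x)"
    if "Poly_Mapping.keys r \<subseteq> ?A" for r
    unfolding monom_map_def using that by (intro prod.mono_neutral_left) (auto simp: in_keys_iff)
  then show ?thesis
    using keys_add[of s t] by (simp add: lookup_add power_add prod.distrib)
qed

lemma sym_map_superset: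
  assumes "finite A" "Poly_Mapping.keys p \<subseteq> A"
  shows "sym_map f p = (\<Sum>t\<in>A. Const (Poly_Mapping.lookup p t) * monom_map f t)"
  unfolding sym_map_def monom_map_def
  by (rule sum.mono_neutral_left) (use assms in \<open>auto simp: in_keys_iff Const_0\<close>)

lemma sym_map_add: "sym_map f (p + q) = sym_map f p + sym_map f q"
proof -
  let ?A = "Poly_Mapping.keys p \<union> Poly_Mapping.keys q"
  have "sym_map f r = (\<Sum>t\<in>?A. Const (Poly_Mapping.lookup r t) * monom_map f t)"
    if "Poly_Mapping.keys r \<subseteq> ?A" for r
    using that by (intro sym_map_superset) auto
  then show ?thesis
    using keys_add[of p q] by (simp add: lookup_add Const_add algebra_simps sum.distrib)
qed

lemma sym_map_0: "sym_map f 0 = 0"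
  by (simp add: sym_map_def)

lemma sym_map_sum: "sym_map f (sum g A) = (\<Sum>x\<in>A. sym_map f (g x))"
  by (induction A rule: infinite_finite_induct) (auto simp: sym_map_0 sym_map_add)

lemma sym_map_single: "sym_map f (Poly_Mapping.single t c) = Const c * monom_map f t"
  by (simp add: sym_map_superset[of "{t}"])

text \<open>Both factors split into monomials, on which multiplicativity is
  \<open>monom_map_add\<close>; additivity does the rest.\<close>

lemma sym_map_mult: "sym_map f (p * q) = sym_map f p * sym_map f q"
proof -
  let ?s = "\<lambda>p t. Poly_Mapping.single t (Poly_Mapping.lookup p t)"
  have "sym_map f (p * q)
      = sym_map f ((\<Sum>s\<in>Poly_Mapping.keys p. ?s p s) * (\<Sum>t\<in>Poly_Mapping.keys q. ?s q t))"
    by (simp flip: poly_mapping_eq_sum_single)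
  also have "\<dots> = (\<Sum>s\<in>Poly_Mapping.keys p. \<Sum>t\<in>Poly_Mapping.keys q.
      sym_map f (?s p s) * sym_map f (?s q t))"
    by (simp add: sum_product sym_map_sum mult_single sym_map_single monom_map_add Const_mult mult_ac)
  also have "\<dots> = sym_map f (\<Sum>s\<in>Poly_Mapping.keys p. ?s p s)
      * sym_map f (\<Sum>t\<in>Poly_Mapping.keys q. ?s q t)"
    by (simp only: sum_product sym_map_sum)
  finally show ?thesis
    by (simp flip: poly_mapping_eq_sum_single)
qed

lemma sym_map_Const: "sym_map f (Const c) = Const c"
  using sym_map_single[of f 0 c] by (simp add: monom_map_def Const_def)

lemma sym_map_Var: "sym_map f (Var x) = linear_form (f x)"
  by (simp add: Var_def sym_map_single monom_map_def Const_1)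

lemma sym_map_uminus: "sym_map f (- p) = - sym_map f p"
  using sym_map_add[of f p "- p"] by (simp add: sym_map_0 eq_neg_iff_add_eq_0 add.commute)

lemma sym_map_diff: "sym_map f (p - q) = sym_map f p - sym_map f q"
  using sym_map_add[of f p "- q"] by (simp add: sym_map_uminus)

section \<open>Sym(U) as a commutative ring, and its ideals\<close>

lemma sym_carrier_1: "1 \<in> sym_carrier U"
  using sym_carrier.const[of 1 U] by (simp add: Const_1)

lemma sym_carrier_0: "0 \<in> sym_carrier U"
  using sym_carrier.const[of 0 U] by (simp add: Const_0)

lemma sym_carrier_uminus: "p \<in> sym_carrier U \<Longrightarrow> - p \<in> sym_carrier U"
  using sym_carrier.mult[OF sym_carrier.const[of "- 1"], of p U] by (simp add: Const_uminus Const_1)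

lemma sym_carrier_sum: "(\<And>x. x \<in> A \<Longrightarrow> f x \<in> sym_carrier U) \<Longrightarrow> sum f A \<in> sym_carrier U"
  by (induction A rule: infinite_finite_induct) (auto intro: sym_carrier_0 sym_carrier.add)

lemma cring_Sym: "cring (Sym U)"
proof (intro cringI abelian_groupI comm_monoidI)
  show "\<exists>y\<in>carrier (Sym U). y \<oplus>\<^bsub>Sym U\<^esub> x = \<zero>\<^bsub>Sym U\<^esub>" if "x \<in> carrier (Sym U)" for x
    using that sym_carrier_uminus[of x U] by (auto simp: Sym_def intro!: bexI[of _ "- x"])
qed (auto simp: Sym_def algebra_simps intro: sym_carrier.intros sym_carrier_0 sym_carrier_1)

lemma a_inv_Sym:
  assumes "p \<in> sym_carrier U"
  shows "\<ominus>\<^bsub>Sym U\<^esub> p = - p"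
proof -
  interpret cring "Sym U" by (rule cring_Sym)
  have "- p \<oplus>\<^bsub>Sym U\<^esub> p = \<zero>\<^bsub>Sym U\<^esub>" by (simp add: Sym_def)
  then show ?thesis
    using minus_equality[of "- p" p] assms sym_carrier_uminus[of p U] by (simp add: Sym_def)
qed

text \<open>Bridge between ideals of the record \<open>Sym U\<close> and ideals described by the
  type class operations, in which the computations take place.\<close>

lemma ideal_Sym_iff: "ideal I (Sym U) \<longleftrightarrow> subring_ideal (sym_carrier U) I"
proof
  assume "ideal I (Sym U)"
  then interpret ideal I "Sym U" .
  show "subring_ideal (sym_carrier U) I"
  proof
    show "p + q \<in> I" if "p \<in> I" "q \<in> I" for p q
      using additive_subgroup.a_closed[OF is_additive_subgroup that] by (simp add: Sym_def)
    show "p * q \<in> I" if "p \<in> sym_carrier U" "q \<in> I" for p q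
      using I_l_closed[of q p] that by (simp add: Sym_def)
    show "I \<subseteq> sym_carrier U" using a_subset by (simp add: Sym_def)
    show "0 \<in> I" using additive_subgroup.zero_closed[OF is_additive_subgroup] by (simp add: Sym_def)
  qed (auto intro: sym_carrier.intros sym_carrier_uminus sym_carrier_1)
next
  assume "subring_ideal (sym_carrier U) I"
  then interpret subring_ideal "sym_carrier U" I .
  interpret R: cring "Sym U" by (rule cring_Sym)
  show "ideal I (Sym U)"
  proof (rule idealI)
    show "subgroup I (add_monoid (Sym U))"
    proof
      fix x assume x: "x \<in> I"
      have "\<ominus>\<^bsub>Sym U\<^esub> x \<in> I" using x ideal_subset by (subst a_inv_Sym) (auto intro: ideal_uminus)
      then show "inv\<^bsub>add_monoid (Sym U)\<^esub> x \<in> I" by (simp add: a_inv_def)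
    qed (use ideal_subset ideal_zero ideal_add in \<open>auto simp: Sym_def\<close>)
    show "x \<otimes>\<^bsub>Sym U\<^esub> a \<in> I" if "a \<in> I" "x \<in> carrier (Sym U)" for a x
      using ideal_mult[of x a] that by (simp add: Sym_def)
    show "a \<otimes>\<^bsub>Sym U\<^esub> x \<in> I" if "a \<in> I" "x \<in> carrier (Sym U)" for a x
      using ideal_mult[of x a] that by (simp add: Sym_def mult.commute)
  qed (rule R.ring_axioms)
qed

text \<open>The universal property of the generated ideal, in terms of
  \<open>subring_ideal\<close>.\<close>

lemma genideal_Sym:
  assumes "G \<subseteq> sym_carrier U"
  shows "subring_ideal (sym_carrier U) (genideal (Sym U) G)" "G \<subseteq> genideal (Sym U) G"
    "subring_ideal (sym_carrier U) I \<Longrightarrow> G \<subseteq> I \<Longrightarrow> genideal (Sym U) G \<subseteq> I"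
proof -
  interpret cring "Sym U" by (rule cring_Sym)
  have G: "G \<subseteq> carrier (Sym U)" using assms by (simp add: Sym_def)
  show "subring_ideal (sym_carrier U) (genideal (Sym U) G)"
    using genideal_ideal[OF G] by (simp add: ideal_Sym_iff)
  show "G \<subseteq> genideal (Sym U) G"
    using genideal_self[OF G] .
  show "genideal (Sym U) G \<subseteq> I" if "subring_ideal (sym_carrier U) I" "G \<subseteq> I"
    using genideal_minimal[of I G] that by (simp add: ideal_Sym_iff)
qed

section \<open>The kernel as a space of flows\<close>

lemma omega_power: "0 < m \<Longrightarrow> omega m ^ k = cis (2 * pi * real k / real m)"
  by (simp add: omega_def cis_conv_exp mult_ac flip: exp_of_nat_mult)

lemma omega_root: "0 < m \<Longrightarrow> omega m ^ m = 1"
  by (simp add: omega_power)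

lemma omega_inj:
  assumes "0 < m" "k < m" "l < m" "omega m ^ k = omega m ^ l"
  shows "k = l"
  using bij_betw_imp_inj_on[OF bij_betw_roots_unity[OF assms(1)]] assms
  by (auto simp: omega_power inj_on_def)

lemma omega_surj:
  assumes "0 < m" "z ^ m = 1"
  obtains k where "z = omega m ^ k"
  using bij_betw_imp_surj_on[OF bij_betw_roots_unity[OF assms(1)]] assms
  by (auto simp: omega_power image_iff)

lemma omega_nonzero: "omega m \<noteq> 0"
  by (simp add: omega_def)

lemma omega_powi_mod:
  assumes "0 < m"
  shows "omega m powi (p mod int m) = omega m powi p"
  by (rule powi_mod_root_of_unity[OF omega_nonzero omega_root[OF assms]])

lemma omega_powi_eq_nat:
  assumes "0 < m"
  shows "omega m powi p = omega m ^ nat (p mod int m)"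
  using assms omega_powi_mod[OF assms, of p] by (simp add: power_int_def)

lemma omega_powi_inj:
  assumes "0 < m" "omega m powi p = omega m powi q"
  shows "p mod int m = q mod int m"
proof -
  have "nat (p mod int m) = nat (q mod int m)"
    by (rule omega_inj[OF assms(1)]) (use assms in \<open>simp_all add: nat_less_iff flip: omega_powi_eq_nat\<close>)
  then show ?thesis using assms(1) eq_nat_nat_iff[of "p mod int m" "q mod int m"] by simp
qed

text \<open>For \<open>j < i\<close> the vector \<open>e_i - \<omega>^k e_j\<close> is
  \<open>- \<omega>^k\<close> times the normal with ends \<open>j\<close>, \<open>i\<close> and
  label \<open>- k\<close>. \<open>diff_refl\<close> gives that index and \<open>diff_scale\<close>
  that factor, so one formula for \<open>y i j k\<close> covers both orientations.\<close>

definition diff_refl :: "nat \<Rightarrow> nat \<Rightarrow> nat \<Rightarrow> int \<Rightarrow> refl" where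
  "diff_refl m i j k =
     (if i < j then Diff i j (nat (k mod int m)) else Diff j i (nat ((- k) mod int m)))"

definition diff_scale :: "nat \<Rightarrow> nat \<Rightarrow> nat \<Rightarrow> int \<Rightarrow> complex" where
  "diff_scale m i j k = (if i < j then 1 else - (omega m powi k))"

lemma diff_scale_nonzero: "diff_scale m i j k \<noteq> 0"
  by (simp add: diff_scale_def omega_nonzero)

lemma yvec_eq:
  assumes "0 < m"
  shows "yvec m i j k = hvec (Coord i) - cvec_scale (omega m powi k) (hvec (Coord j))
    - cvec_scale (diff_scale m i j k) (hvec (diff_refl m i j k))"
proof (rule poly_mapping_eqI)
  fix g
  show "Poly_Mapping.lookup (yvec m i j k) g = Poly_Mapping.lookup (hvec (Coord i)
      - cvec_scale (omega m powi k) (hvec (Coord j))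
      - cvec_scale (diff_scale m i j k) (hvec (diff_refl m i j k))) g"
    using power_int_add[of "omega m" k "- k"] omega_nonzero[of m]
    by (simp add: yvec_def y_upper_def diff_scale_def diff_refl_def lookup_minus lookup_cvec_scale
        right_diff_distrib flip: mult.assoc)
qed

lemma yvec_mod: "0 < m \<Longrightarrow> yvec m i j (k mod int m) = yvec m i j k"
  by (simp add: yvec_eq diff_scale_def diff_refl_def omega_powi_mod mod_minus_eq)

lemma yvec_skew:
  assumes "i \<noteq> j"
  shows "yvec m i j k = - cvec_scale (omega m powi k) (yvec m j i (- k))"
proof (cases "i < j")
  case True
  have "omega m powi k * omega m powi (- k) = 1"
    using power_int_add[of "omega m" k "- k"] omega_nonzero[of m] by simp
  then show ?thesis
    using True
    by (intro poly_mapping_eqI) (simp add: yvec_def lookup_cvec_scale flip: mult.assoc)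
next
  case False
  then have "j < i" using assms by simp
  then show ?thesis by (simp add: yvec_def)
qed

lemma finite_refls: "finite (refls m n)"
proof -
  have "refls m n \<subseteq> Coord ` {..<n} \<union> (\<lambda>(i, j, k). Diff i j k) ` ({..<n} \<times> {..<n} \<times> {..<m})"
  proof
    fix g assume g: "g \<in> refls m n"
    show "g \<in> Coord ` {..<n} \<union> (\<lambda>(i, j, k). Diff i j k) ` ({..<n} \<times> {..<n} \<times> {..<m})"
    proof (cases g)
      case (Diff i j k)
      then show ?thesis using g by (intro UnI2 rev_image_eqI[of "(i, j, k)"]) (auto simp: refls_def)
    qed (use g in \<open>auto simp: refls_def\<close>)
  qed
  then show ?thesis by (rule finite_subset) auto
qed

text \<open>Summing over all of \<open>refls m n\<close> instead of the keys makes linearity in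
  \<open>u\<close> immediate.\<close>

definition phi_at :: "nat \<Rightarrow> nat \<Rightarrow> refl cvec \<Rightarrow> nat \<Rightarrow> complex" where
  "phi_at m n u r = (\<Sum>g\<in>refls m n. Poly_Mapping.lookup u g * normal_vec m n g $ r)"

lemma Ker_iff: "u \<in> Ker m n \<longleftrightarrow> Poly_Mapping.keys u \<subseteq> refls m n \<and> (\<forall>r<n. phi_at m n u r = 0)"
proof -
  have "phi m n u $ r = phi_at m n u r" if "Poly_Mapping.keys u \<subseteq> refls m n" "r < n" for r
    unfolding phi_at_def phi_def using that(2)
    by simp (rule sum.mono_neutral_left, use that finite_refls in \<open>auto simp: in_keys_iff\<close>)
  then show ?thesis
    by (auto simp: Ker_def vec_eq_iff) (auto simp: phi_def)
qed

lemma phi_at_add: "phi_at m n (u + v) r = phi_at m n u r + phi_at m n v r"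
  by (simp add: phi_at_def lookup_add algebra_simps sum.distrib)

lemma phi_at_diff: "phi_at m n (u - v) r = phi_at m n u r - phi_at m n v r"
  by (simp add: phi_at_def lookup_minus algebra_simps sum_subtractf)

lemma phi_at_scale: "phi_at m n (cvec_scale c u) r = c * phi_at m n u r"
  by (simp add: phi_at_def lookup_cvec_scale sum_distrib_left mult.assoc)

lemma phi_at_hvec: "g \<in> refls m n \<Longrightarrow> phi_at m n (hvec g) r = normal_vec m n g $ r"
  by (simp add: phi_at_def hvec_def lookup_single when_def if_distrib[of "\<lambda>x. x * _"] finite_refls
      cong: if_cong)

lemma Ker_0: "0 \<in> Ker m n"
  by (simp add: Ker_iff phi_at_def)

lemma Ker_diff: "u \<in> Ker m n \<Longrightarrow> v \<in> Ker m n \<Longrightarrow> u - v \<in> Ker m n"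
  using keys_diff[of u v] by (auto simp: Ker_iff phi_at_diff)

lemma Ker_add: "u \<in> Ker m n \<Longrightarrow> v \<in> Ker m n \<Longrightarrow> u + v \<in> Ker m n"
  using keys_add[of u v] by (auto simp: Ker_iff phi_at_add)

lemma Ker_scale: "u \<in> Ker m n \<Longrightarrow> cvec_scale c u \<in> Ker m n"
  by (auto simp: Ker_iff phi_at_scale in_keys_iff lookup_cvec_scale)

lemma Ker_sum: "(\<And>x. x \<in> A \<Longrightarrow> f x \<in> Ker m n) \<Longrightarrow> sum f A \<in> Ker m n"
  by (induction A rule: infinite_finite_induct) (auto intro: Ker_0 Ker_add)

lemma diff_refl_in_refls: "0 < m \<Longrightarrow> i < n \<Longrightarrow> j < n \<Longrightarrow> i \<noteq> j \<Longrightarrow> diff_refl m i j k \<in> refls m n"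
  by (auto simp: diff_refl_def refls_def nat_less_iff)

lemma Coord_in_refls [simp]: "Coord i \<in> refls m n \<longleftrightarrow> i < n"
  by (auto simp: refls_def)

lemma Diff_in_refls [simp]: "Diff i j k \<in> refls m n \<longleftrightarrow> i < j \<and> j < n \<and> k < m"
  by (auto simp: refls_def)

lemma diff_normal:
  assumes "0 < m" "i < n" "j < n" "i \<noteq> j" "r < n"
  shows "diff_scale m i j k * normal_vec m n (diff_refl m i j k) $ r
    = (if r = i then 1 else 0) - omega m powi k * (if r = j then 1 else 0)"
proof -
  have "omega m powi k * omega m powi (- k) = 1"
    using power_int_add[of "omega m" k "- k"] omega_nonzero[of m] by simp
  then show ?thesis
    using assms
    by (auto simp: diff_scale_def diff_refl_def unit_vec_def algebra_simps simp flip: omega_powi_eq_nat)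
qed

lemma yvec_Ker:
  assumes "0 < m" "i < n" "j < n" "i \<noteq> j"
  shows "yvec m i j k \<in> Ker m n"
  unfolding Ker_iff
proof (intro conjI allI impI)
  show "Poly_Mapping.keys (yvec m i j k) \<subseteq> refls m n"
    using assms diff_refl_in_refls[OF assms, of k]
    by (auto simp: yvec_eq in_keys_iff lookup_minus lookup_cvec_scale hvec_def lookup_single when_def
        split: if_splits)
  show "phi_at m n (yvec m i j k) r = 0" if "r < n" for r
    using assms that diff_normal[OF assms that, of k]
    by (simp add: yvec_eq phi_at_diff phi_at_scale phi_at_hvec diff_refl_in_refls unit_vec_def)
qed

section \<open>The kernel K in flow coordinates\<close>

locale reflection_arrangement =
  fixes m n :: nat
  assumes m_ge: "2 \<le> m" and n_ge: "3 \<le> n"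
begin

lemma m_pos: "0 < m"
  using m_ge by simp

abbreviation K :: "refl cvec set" where "K \<equiv> Ker m n"
abbreviation S :: "refl cpoly set" where "S \<equiv> sym_carrier K"
abbreviation w :: complex where "w \<equiv> omega m"
abbreviation Yf :: "nat \<Rightarrow> nat \<Rightarrow> int \<Rightarrow> refl cpoly" where "Yf \<equiv> yform m"

lemma subring_ideal_S: "subring_ideal S S"
  by standard (auto intro: sym_carrier.intros sym_carrier_uminus sym_carrier_1 sym_carrier_0)

lemma Yf_mem: "i < n \<Longrightarrow> j < n \<Longrightarrow> i \<noteq> j \<Longrightarrow> Yf i j k \<in> S"
  unfolding yform_def by (intro sym_carrier.linear yvec_Ker m_pos)

text \<open>Skewness and periodicity hold in Sym(K) itself; only the two families of relations
  depend on \<open>J\<close>.\<close>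

lemma gain_algebraI:
  assumes "subring_ideal S J"
    and "\<And>i j p q. i < n \<Longrightarrow> j < n \<Longrightarrow> i \<noteq> j \<Longrightarrow> Yf i j p * Yf i j q \<in> J"
    and "\<And>i v j p q. i < n \<Longrightarrow> v < n \<Longrightarrow> j < n \<Longrightarrow> distinct [i, v, j] \<Longrightarrow>
      Yf i v p * Yf v j q - Yf i j (p + q) * Yf v j q
        - Const (w powi (- p)) * (Yf i v p * Yf i j (p + q)) \<in> J"
  shows "gain_algebra S J Const w m n Yf"
proof -
  interpret subring_ideal S J by fact
  show ?thesis
  proof
    show "Yf i j (k mod int m) = Yf i j k" for i j k
      by (simp add: yform_def yvec_mod m_pos)
    show "Yf i j k = - (Const (w powi k) * Yf j i (- k))" if "i \<noteq> j" for i j k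
      unfolding yform_def by (subst yvec_skew[OF that]) (simp only: linear_form_uminus linear_form_scale)
    show "w powi p = w powi q \<Longrightarrow> p mod int m = q mod int m" for p q
      using omega_powi_inj m_pos by blast
  qed (use assms m_pos in \<open>auto simp: Const_add Const_mult Const_1 omega_root
    intro: Yf_mem sym_carrier.const\<close>)
qed

lemma gain_S: "gain_algebra S S Const w m n Yf"
proof -
  interpret subring_ideal S S by (rule subring_ideal_S)
  have *: "a - b - c \<in> S" if "a \<in> S" "b \<in> S" "c \<in> S" for a b c
    using that ideal_diff by blast
  show ?thesis
  proof (rule gain_algebraI[OF subring_ideal_S])
    show "Yf i j p * Yf i j q \<in> S" if "i < n" "j < n" "i \<noteq> j" for i j p q
      using that by (intro sym_carrier.mult Yf_mem)
    show "Yf i v p * Yf v j q - Yf i j (p + q) * Yf v j q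
        - Const (w powi (- p)) * (Yf i v p * Yf i j (p + q)) \<in> S"
      if "i < n" "v < n" "j < n" "distinct [i, v, j]" for i v j p q
      using that by (intro * sym_carrier.mult Yf_mem sym_carrier.const) auto
  qed
qed

text \<open>The improper ideal \<open>S\<close> trivially satisfies all relations; this instance only provides the
  vocabulary of flows, which does not depend on the ideal.\<close>

sublocale gain: gain_algebra S S Const "omega m" m n "yform m"
  by (rule gain_S)

text \<open>The sign comes from the entry -1 of \<open>y_ij^k\<close> at \<open>h_ij^k\<close>; the
  branch for \<open>j < i\<close> is the value dictated by skewness.\<close>

definition coef :: "refl cvec \<Rightarrow> nat \<Rightarrow> nat \<Rightarrow> int \<Rightarrow> complex" where
  "coef u i j k = (if i < j \<and> j < n then - Poly_Mapping.lookup u (Diff i j (nat (k mod int m)))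
     else if j < i \<and> i < n then w powi (- k) * Poly_Mapping.lookup u (Diff j i (nat ((- k) mod int m)))
     else 0)"

lemma flow_coef: "gain.flow (coef u)"
  unfolding gain.flow_def
proof (intro conjI allI)
  fix i j k
  have w: "w powi k * w powi (- k) = 1"
    using power_int_add[of w k "- k"] omega_nonzero[of m] by simp
  show "coef u i j (k mod int m) = coef u i j k"
    using omega_powi_mod[OF m_pos, of "- (k mod int m)"] omega_powi_mod[OF m_pos, of "- k"]
    by (simp add: coef_def mod_minus_eq)
  show "coef u j i (- k) = - (w powi k) * coef u i j k"
    using w by (auto simp: coef_def simp flip: mult.assoc)
  show "coef u i j k \<noteq> 0 \<longrightarrow> i < n \<and> j < n \<and> i \<noteq> j"
    by (auto simp: coef_def)
qed

lemma sum_refls: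
  "(\<Sum>g\<in>refls m n. F g) = (\<Sum>i<n. F (Coord i)) + (\<Sum>(i, j, k)\<in>gain.upper. F (Diff i j (nat k)))"
proof -
  let ?D = "(\<lambda>(i, j, k). Diff i j (nat k))"
  have inj: "inj_on ?D gain.upper"
    by (auto simp: inj_on_def gain.upper_def)
  have "refls m n = Coord ` {..<n} \<union> ?D ` gain.upper"
  proof (intro equalityI subsetI)
    fix g assume g: "g \<in> refls m n"
    show "g \<in> Coord ` {..<n} \<union> ?D ` gain.upper"
    proof (cases g)
      case (Diff i j k)
      then have "(i, j, int k) \<in> gain.upper" using g by (auto simp: gain.upper_def)
      then show ?thesis using Diff by (auto intro: rev_image_eqI)
    qed (use g in auto)
  qed (auto simp: gain.upper_def nat_less_iff)
  then have "(\<Sum>g\<in>refls m n. F g) = (\<Sum>g\<in>Coord ` {..<n}. F g) + (\<Sum>g\<in>?D ` gain.upper. F g)"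
    by (simp only:) (rule sum.union_disjoint, auto simp: gain.finite_upper)
  also have "\<dots> = (\<Sum>i<n. F (Coord i)) + (\<Sum>(i, j, k)\<in>gain.upper. F (Diff i j (nat k)))"
  proof -
    have "(\<Sum>g\<in>Coord ` {..<n}. F g) = (\<Sum>i<n. F (Coord i))"
      by (simp add: sum.reindex inj_on_def)
    moreover have "(\<Sum>g\<in>?D ` gain.upper. F g) = (\<Sum>(i, j, k)\<in>gain.upper. F (Diff i j (nat k)))"
      unfolding sum.reindex[OF inj] by (intro sum.cong refl) auto
    ultimately show ?thesis by simp
  qed
  finally show ?thesis .
qed

text \<open>This is component \<open>r\<close> of \<open>phi m n u = 0\<close>, solved for the
  coordinate at \<open>h_r\<close>.\<close>

lemma Ker_lookup_Coord:
  assumes u: "u \<in> K" and r: "r < n"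
  shows "Poly_Mapping.lookup u (Coord r)
    = (\<Sum>(i, j, k)\<in>gain.upper. coef u i j k * ((if r = i then 1 else 0) - w powi k * (if r = j then 1 else 0)))"
proof -
  have "0 = phi_at m n u r" using assms by (simp add: Ker_iff)
  also have "\<dots> = (\<Sum>i<n. Poly_Mapping.lookup u (Coord i) * (if r = i then 1 else 0))
      - (\<Sum>(i, j, k)\<in>gain.upper. coef u i j k * ((if r = i then 1 else 0) - w powi k * (if r = j then 1 else 0)))"
    unfolding phi_at_def sum_refls diff_conv_add_uminus sum_negf[symmetric]
    using r m_pos
    by (intro arg_cong2[of _ _ _ _ "(+)"] sum.cong refl)
      (auto simp: gain.upper_def unit_vec_def coef_def omega_powi_eq_nat)
  finally show ?thesis using r by (simp add: if_distrib cong: if_cong)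
qed

lemma Ker_eq_0:
  assumes "u \<in> K" "\<And>i j k. i < j \<Longrightarrow> j < n \<Longrightarrow> k < m \<Longrightarrow> Poly_Mapping.lookup u (Diff i j k) = 0"
  shows "u = 0"
proof -
  have "coef u i j k = 0" for i j k
    using assms(2) m_pos by (auto simp: coef_def nat_less_iff)
  then have "Poly_Mapping.lookup u (Coord r) = 0" if "r < n" for r
    using Ker_lookup_Coord[OF assms(1) that] by simp
  then have "Poly_Mapping.lookup u g = 0" if "g \<in> refls m n" for g
    using that assms(2) by (cases g) auto
  then show ?thesis
    using assms(1) by (intro poly_mapping_eqI) (metis Ker_iff in_keys_iff lookup_zero subset_iff)
qed

text \<open>Both sides lie in K and have the same \<open>Diff\<close> coordinates, since each
  \<open>Diff\<close> index occurs in exactly one summand; by \<open>Ker_eq_0\<close> these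
  coordinates determine a vector of K.\<close>

lemma Ker_expansion:
  assumes u: "u \<in> K"
  shows "u = (\<Sum>(i, j, k)\<in>gain.upper. cvec_scale (coef u i j k) (yvec m i j k))" (is "u = ?v")
proof -
  have "?v \<in> K"
    by (rule Ker_sum) (auto simp: gain.upper_def intro!: Ker_scale yvec_Ker m_pos)
  then have "u - ?v \<in> K" by (rule Ker_diff[OF u])
  moreover have "Poly_Mapping.lookup (u - ?v) (Diff a b l) = 0" if "a < b" "b < n" "l < m" for a b l
  proof -
    have "Poly_Mapping.lookup ?v (Diff a b l)
        = (\<Sum>e\<in>gain.upper. if e = (a, b, int l) then Poly_Mapping.lookup u (Diff a b l) else 0)"
      unfolding lookup_sum using m_pos
      by (intro sum.cong refl)
        (auto simp: gain.upper_def lookup_cvec_scale yvec_eq lookup_minus hvec_def lookup_single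
          diff_refl_def diff_scale_def coef_def when_def split: if_splits)
    then show ?thesis
      using that by (simp add: lookup_minus gain.finite_upper) (simp add: gain.upper_def)
  qed
  ultimately have "u - ?v = 0" by (rule Ker_eq_0)
  then show ?thesis by simp
qed

lemma linear_form_Ker:
  assumes "u \<in> K"
  shows "linear_form u = gain.lin (coef u)"
  by (subst Ker_expansion[OF assms])
    (simp add: linear_form_sum gain.lin_def case_prod_unfold linear_form_scale yform_def)

text \<open>An edge from \<open>i\<close> to \<open>j\<close> adds its coefficient at
  \<open>i\<close> and \<open>- (w powi k)\<close> times it at \<open>j\<close>. The latter is the
  coefficient of the reversed edge, so the total at \<open>r\<close> is the net flow.\<close>

lemma lookup_Coord_net:
  assumes u: "u \<in> K" and r: "r < n"
  shows "Poly_Mapping.lookup u (Coord r) = gain.net (coef u) r"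
proof -
  let ?I = "{0..<int m}" and ?a = "coef u"
  have up: "(\<Sum>(i, j, k)\<in>gain.upper. F i j k) = (\<Sum>i<n. \<Sum>j<n. \<Sum>k\<in>?I. if i < j then F i j k else 0)"
    for F :: "nat \<Rightarrow> nat \<Rightarrow> int \<Rightarrow> complex"
  proof -
    have "(\<Sum>i<n. \<Sum>j<n. \<Sum>k\<in>?I. if i < j then F i j k else 0)
        = (\<Sum>(i, j, k)\<in>{..<n} \<times> {..<n} \<times> ?I. if i < j then F i j k else 0)"
      by (simp add: sum.cartesian_product)
    also have "\<dots> = (\<Sum>(i, j, k)\<in>gain.upper. F i j k)"
      by (rule sum.mono_neutral_cong_right) (auto simp: gain.upper_def split: if_splits)
    finally show ?thesis by simp
  qed
  \<comment> \<open>Negating labels modulo \<open>m\<close> permutes them and turns incoming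
    coefficients into outgoing ones.\<close>
  have refl: "(\<Sum>k\<in>?I. - (w powi k) * ?a j r k) = (\<Sum>k\<in>?I. ?a r j k)" for j
  proof (rule sum.reindex_bij_witness[of _ "\<lambda>k. (- k) mod int m" "\<lambda>k. (- k) mod int m"])
    fix k assume "k \<in> ?I"
    then show "?a r j ((- k) mod int m) = - (w powi k) * ?a j r k"
      by (simp add: gain.flow_mod[OF flow_coef] gain.flow_skew[OF flow_coef[of u], of r j k])
  qed (use m_pos in \<open>auto simp: mod_minus_eq\<close>)
  have "Poly_Mapping.lookup u (Coord r)
      = (\<Sum>i<n. \<Sum>j<n. \<Sum>k\<in>?I. (if i = r then if r < j then ?a r j k else 0 else 0))
        + (\<Sum>i<n. \<Sum>j<n. \<Sum>k\<in>?I. (if j = r then if i < r then - (w powi k) * ?a i r k else 0 else 0))"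
    unfolding Ker_lookup_Coord[OF u r] up sum.distrib[symmetric]
    by (intro sum.cong refl) auto
  also have "(\<Sum>i<n. \<Sum>j<n. \<Sum>k\<in>?I. (if i = r then if r < j then ?a r j k else 0 else 0))
      = (\<Sum>i<n. if i = r then (\<Sum>j<n. \<Sum>k\<in>?I. if r < j then ?a r j k else 0) else 0)"
    by (intro sum.cong refl) auto
  also have "\<dots> = (\<Sum>j<n. if r < j then (\<Sum>k\<in>?I. ?a r j k) else 0)"
    using r by simp (intro sum.cong refl, auto)
  also have "(\<Sum>i<n. \<Sum>j<n. \<Sum>k\<in>?I. (if j = r then if i < r then - (w powi k) * ?a i r k else 0 else 0))
      = (\<Sum>i<n. \<Sum>j<n. if j = r then (\<Sum>k\<in>?I. if i < r then - (w powi k) * ?a i r k else 0) else 0)"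
    by (intro sum.cong refl) auto
  also have "\<dots> = (\<Sum>i<n. if i < r then (\<Sum>k\<in>?I. - (w powi k) * ?a i r k) else 0)"
    using r by simp (intro sum.cong refl, auto)
  also have "\<dots> = (\<Sum>i<n. if i < r then (\<Sum>k\<in>?I. ?a r i k) else 0)"
    unfolding refl ..
  also have "(\<Sum>j<n. if r < j then (\<Sum>k\<in>?I. ?a r j k) else 0) + \<dots> = (\<Sum>j<n. \<Sum>k\<in>?I. ?a r j k)"
    unfolding sum.distrib[symmetric]
    by (intro sum.cong refl) (auto simp: coef_def nat_neq_iff[of r])
  finally show ?thesis by (simp add: gain.net_def)
qed

text \<open>Nonzero \<open>Diff\<close> coordinates are the edges of the flow, nonzero
  \<open>Coord\<close> coordinates its sources.\<close>

lemma card_keys: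
  assumes u: "u \<in> K"
  shows "card (Poly_Mapping.keys u) = card (gain.supp (coef u)) + card (gain.sources (coef u))"
proof -
  let ?D = "(\<lambda>(i, j, k). Diff i j (nat k))"
  have "Poly_Mapping.keys u = ?D ` gain.supp (coef u) \<union> Coord ` gain.sources (coef u)"
  proof (intro equalityI subsetI)
    fix g assume g: "g \<in> Poly_Mapping.keys u"
    then have "g \<in> refls m n" using u by (auto simp: Ker_iff)
    then show "g \<in> ?D ` gain.supp (coef u) \<union> Coord ` gain.sources (coef u)"
    proof (cases g)
      case (Coord i)
      then show ?thesis
        using g \<open>g \<in> refls m n\<close> lookup_Coord_net[OF u, of i] by (auto simp: gain.sources_def in_keys_iff)
    next
      case (Diff i j k)
      then have "(i, j, int k) \<in> gain.supp (coef u)"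
        using g \<open>g \<in> refls m n\<close> by (simp add: gain.supp_def gain.upper_def coef_def in_keys_iff)
      then show ?thesis using Diff by (force simp: image_iff)
    qed
  next
    fix g assume "g \<in> ?D ` gain.supp (coef u) \<union> Coord ` gain.sources (coef u)"
    then show "g \<in> Poly_Mapping.keys u"
      using lookup_Coord_net[OF u]
      by (auto simp: gain.supp_def gain.upper_def gain.sources_def coef_def in_keys_iff)
  qed
  moreover have "inj_on ?D (gain.supp (coef u))"
    by (auto simp: inj_on_def gain.supp_def gain.upper_def)
  moreover have "inj_on Coord (gain.sources (coef u))" by (simp add: inj_on_def)
  moreover have "finite (gain.sources (coef u))" by (simp add: gain.sources_def)
  ultimately show ?thesis
    by (subst card_Un_disjoint[symmetric, THEN trans[rotated]])
      (auto simp: card_image gain.finite_supp card_Un_disjoint)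
qed

text \<open>\<open>card_keys\<close> identifies the exponent with that of \<open>lin_power\<close>,
  and \<open>Ker_eq_0\<close> supplies a nonzero edge coefficient.\<close>

lemma linear_form_power:
  assumes J: "gain_algebra S J Const w m n Yf" and u: "u \<in> K" "u \<noteq> 0"
  shows "linear_form u ^ (card (Poly_Mapping.keys u) - 1) \<in> J"
proof -
  interpret J: gain_algebra S J Const w m n Yf by (rule J)
  obtain i j k where "i < j" "j < n" "k < m" "Poly_Mapping.lookup u (Diff i j k) \<noteq> 0"
    using Ker_eq_0[OF u(1)] u(2) by blast
  then have "coef u i j (int k) \<noteq> 0" by (simp add: coef_def)
  then show ?thesis
    using J.lin_power[OF flow_coef] card_keys[OF u(1)] linear_form_Ker[OF u(1)] by simp
qed

end

section \<open>The zonotopal ideal contains the quadratic relations\<close>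

lemma lookup_yvec:
  assumes "0 < m"
  shows "Poly_Mapping.lookup (yvec m i j k) g = (if g = Coord i then 1 else 0)
    - omega m powi k * (if g = Coord j then 1 else 0)
    - diff_scale m i j k * (if g = diff_refl m i j k then 1 else 0)"
  using assms by (simp add: yvec_eq lookup_minus lookup_cvec_scale hvec_def lookup_single when_def)

lemma diff_refl_neq_Coord [simp]: "diff_refl m i j k \<noteq> Coord l" "Coord l \<noteq> diff_refl m i j k"
  by (simp_all add: diff_refl_def)

section \<open>Hyperplanes and the counting function \<open>rho\<close>\<close>

context reflection_arrangement
begin

lemma ex_third: "\<exists>x<n. x \<noteq> i \<and> x \<noteq> j"
proof -
  have "\<exists>x\<in>{0, 1, 2}. x \<noteq> i \<and> x \<noteq> j"
    by auto
  then obtain x where "x \<in> {0, 1, 2}" "x \<noteq> i" "x \<noteq> j" by blast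
  then show ?thesis using n_ge by (intro exI[of _ x]) auto
qed

text \<open>Distinct basis vectors must cut out distinct hyperplanes of K, for otherwise
  \<open>rho\<close> would count fewer hyperplanes than nonzero coordinates. The witness is always a
  single edge.\<close>

lemma separating_vector:
  assumes g: "g \<in> refls m n" and g': "g' \<in> refls m n" and ne: "g \<noteq> g'"
  shows "\<exists>u\<in>K. (Poly_Mapping.lookup u g = 0) \<noteq> (Poly_Mapping.lookup u g' = 0)"
proof -
  note simps = lookup_yvec[OF m_pos] diff_refl_def diff_scale_def
  have CD: "\<exists>u\<in>K. (Poly_Mapping.lookup u (Coord l) = 0) \<noteq> (Poly_Mapping.lookup u (Diff i j k) = 0)"
    if l: "l < n" and ij: "i < j" "j < n" "k < m" for l i j k
  proof (cases "l = i \<or> l = j")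
    case True
    \<comment> \<open>The edge from \<open>l\<close> to a third vertex has a nonzero coordinate at
      \<open>h_l\<close> and none at \<open>h_ij^k\<close>; the bound \<open>n \<ge> 3\<close>
      provides that vertex.\<close>
    obtain x where "x < n" "x \<noteq> i" "x \<noteq> j" using ex_third by blast
    then show ?thesis
      using True l ij yvec_Ker[OF m_pos, of l n x 0]
      by (intro bexI[of _ "yvec m l x 0"]) (auto simp: simps)
  next
    case False
    then show ?thesis
      using ij yvec_Ker[OF m_pos, of i n j "int k"]
      by (intro bexI[of _ "yvec m i j (int k)"]) (auto simp: simps)
  qed
  show ?thesis
  proof (cases g)
    case C: (Coord l)
    show ?thesis
    proof (cases g')
      case (Coord l')
      obtain x where "x < n" "x \<noteq> l" "x \<noteq> l'" using ex_third by blast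
      then show ?thesis
        using C Coord g ne yvec_Ker[OF m_pos, of l n x 0]
        by (intro bexI[of _ "yvec m l x 0"]) (auto simp: simps)
    next
      case (Diff i j k)
      then show ?thesis using C g g' CD by auto
    qed
  next
    case D: (Diff i j k)
    show ?thesis
    proof (cases g')
      case (Coord l)
      then show ?thesis using D g g' CD[of l i j k] by auto
    next
      case (Diff i' j' k')
      then show ?thesis
        using D g ne yvec_Ker[OF m_pos, of i n j "int k"]
        by (intro bexI[of _ "yvec m i j (int k)"]) (auto simp: simps)
    qed
  qed
qed

lemma rho_eq:
  assumes u: "u \<in> K"
  shows "rho (G_perp m n) u = card (Poly_Mapping.keys u)"
proof -
  let ?H = "\<lambda>g. {u \<in> K. Poly_Mapping.lookup u g = 0}"
  have sub: "Poly_Mapping.keys u \<subseteq> refls m n" using u by (simp add: Ker_iff)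
  have "{H \<in> G_perp m n. u \<notin> H} = ?H ` Poly_Mapping.keys u"
    using u sub by (auto simp: G_perp_def in_keys_iff)
  moreover have "inj_on ?H (refls m n)"
  proof (rule inj_onI, rule ccontr)
    fix g g' assume "g \<in> refls m n" "g' \<in> refls m n" "?H g = ?H g'" "g \<noteq> g'"
    then show False using separating_vector[of g g'] by blast
  qed
  then have "inj_on ?H (Poly_Mapping.keys u)" by (rule inj_on_subset[OF _ sub])
  ultimately show ?thesis by (simp add: rho_def card_image)
qed

section \<open>Squares and polarisation in the zonotopal ideal\<close>

abbreviation IZ :: "refl cpoly set" where
  "IZ \<equiv> internal_zonotopal_ideal K (G_perp m n)"

lemma I_ideal: "subring_ideal S IZ"
  and I_gen: "u \<in> K \<Longrightarrow> u \<noteq> 0 \<Longrightarrow> linear_form u ^ (card (Poly_Mapping.keys u) - 1) \<in> IZ"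
  and I_minimal: "subring_ideal S J \<Longrightarrow>
    (\<And>u. u \<in> K \<Longrightarrow> u \<noteq> 0 \<Longrightarrow> linear_form u ^ (card (Poly_Mapping.keys u) - 1) \<in> J) \<Longrightarrow> IZ \<subseteq> J"
proof -
  let ?G = "{linear_form u ^ (rho (G_perp m n) u - 1) | u. u \<in> K \<and> u \<noteq> 0}"
  have G: "?G \<subseteq> S" by (auto intro: gain.power_mem sym_carrier.linear)
  show "subring_ideal S IZ"
    unfolding internal_zonotopal_ideal_def by (rule genideal_Sym(1)[OF G])
  show "linear_form u ^ (card (Poly_Mapping.keys u) - 1) \<in> IZ" if "u \<in> K" "u \<noteq> 0" for u
    using genideal_Sym(2)[OF G] that rho_eq[of u] unfolding internal_zonotopal_ideal_def by force
  show "IZ \<subseteq> J" if "subring_ideal S J"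
    "\<And>u. u \<in> K \<Longrightarrow> u \<noteq> 0 \<Longrightarrow> linear_form u ^ (card (Poly_Mapping.keys u) - 1) \<in> J" for J
    unfolding internal_zonotopal_ideal_def using that rho_eq by (intro genideal_Sym(3)[OF G]) auto
qed

text \<open>With at most three nonzero coordinates the exponent is at most 2. The zero vector gives
  no generator and is treated separately.\<close>

lemma I_square:
  assumes u: "u \<in> K" and "Poly_Mapping.keys u \<subseteq> {a, b, c}"
  shows "(linear_form u)\<^sup>2 \<in> IZ"
proof -
  interpret subring_ideal S IZ by (rule I_ideal)
  show ?thesis
  proof (cases "u = 0")
    case True
    then show ?thesis by (simp add: linear_form_0 ideal_zero)
  next
    case False
    have "card (Poly_Mapping.keys u) \<le> card {a, b, c}"
      by (rule card_mono[OF _ assms(2)]) simp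
    also have "\<dots> \<le> 3" by (simp add: card_insert_if)
    finally show ?thesis
      by (intro ideal_power_mono[OF _ I_gen[OF u False]] sym_carrier.linear u) simp
  qed
qed

lemma Yf_square: 
  assumes "i < n" "j < n" "i \<noteq> j"
  shows "(Yf i j p)\<^sup>2 \<in> IZ"
  unfolding yform_def
proof (rule I_square)
  show "Poly_Mapping.keys (yvec m i j p) \<subseteq> {Coord i, Coord j, diff_refl m i j p}"
    by (auto simp: in_keys_iff lookup_yvec m_pos split: if_splits)
qed (intro yvec_Ker m_pos assms)

text \<open>Both relations arise by polarisation from squares of vectors with at most three nonzero
  coordinates.\<close>

lemma gain_I: "gain_algebra S IZ Const w m n Yf"
proof (rule gain_algebraI[OF I_ideal])
  interpret subring_ideal S IZ by (rule I_ideal)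
  have half: "Const (1 / 2) * 2 = (1 :: refl cpoly)"
    using Const_mult[of "1 / 2" 2, where ?'a = refl] Const_add[of 1 1, where ?'a = refl]
    by (simp add: Const_1)
  show "Yf i j p * Yf i j q \<in> IZ" if ij: "i < n" "j < n" "i \<noteq> j" for i j p q
  proof -
    \<comment> \<open>The coordinate at \<open>h_i\<close> cancels in the difference, which leaves
      \<open>h_j\<close> and two \<open>Diff\<close> coordinates.\<close>
    have "(linear_form (yvec m i j p - yvec m i j q))\<^sup>2 \<in> IZ"
    proof (rule I_square)
      show "Poly_Mapping.keys (yvec m i j p - yvec m i j q)
          \<subseteq> {Coord j, diff_refl m i j p, diff_refl m i j q}"
        by (auto simp: in_keys_iff lookup_yvec lookup_minus m_pos split: if_splits)
    qed (intro Ker_diff yvec_Ker m_pos ij)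
    then have d: "(Yf i j p - Yf i j q)\<^sup>2 \<in> IZ"
      by (simp add: linear_form_diff yform_def)
    have "Yf i j p * Yf i j q = (Const (1 / 2) * 2) * (Yf i j p * Yf i j q)"
      by (simp add: half)
    also have "\<dots> = Const (1 / 2) * ((Yf i j p)\<^sup>2 + (Yf i j q)\<^sup>2 - (Yf i j p - Yf i j q)\<^sup>2)"
      by (simp add: algebra_simps power2_eq_square)
    also have "\<dots> \<in> IZ"
      by (intro ideal_mult ideal_diff ideal_add Yf_square d ij sym_carrier.const)
    finally show ?thesis .
  qed
  show "Yf i v p * Yf v j q - Yf i j (p + q) * Yf v j q
      - Const (w powi (- p)) * (Yf i v p * Yf i j (p + q)) \<in> IZ"
    if ivj: "i < n" "v < n" "j < n" "distinct [i, v, j]" for i v j p q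
  proof -
    define a b c where "a = Yf i v p" and "b = Yf v j q" and "c = Yf i j (p + q)"
    define z z' where "z = (Const (w powi p) :: refl cpoly)" and "z' = (Const (w powi (- p)) :: refl cpoly)"
    have zz: "z * z' = 1" unfolding z_def z'_def by (rule gain.cst_powi_inverse)
    \<comment> \<open>All \<open>Coord\<close> coordinates of this combination cancel.\<close>
    let ?t = "yvec m i v p + cvec_scale (w powi p) (yvec m v j q) - yvec m i j (p + q)"
    have "(linear_form ?t)\<^sup>2 \<in> IZ"
    proof (rule I_square)
      show "Poly_Mapping.keys ?t \<subseteq> {diff_refl m i v p, diff_refl m v j q, diff_refl m i j (p + q)}"
      proof
        fix g assume g: "g \<in> Poly_Mapping.keys ?t"
        show "g \<in> {diff_refl m i v p, diff_refl m v j q, diff_refl m i j (p + q)}"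
        proof (rule ccontr)
          assume "g \<notin> {diff_refl m i v p, diff_refl m v j q, diff_refl m i j (p + q)}"
          then have "Poly_Mapping.lookup ?t g = 0"
            using ivj by (simp add: lookup_yvec lookup_minus lookup_add lookup_cvec_scale m_pos gain.powi_add)
          then show False using g by (simp add: in_keys_iff)
        qed
      qed
    qed (use ivj in \<open>auto intro!: Ker_diff Ker_add Ker_scale yvec_Ker m_pos\<close>)
    then have t: "(a + z * b - c)\<^sup>2 \<in> IZ"
      by (simp add: linear_form_diff linear_form_add linear_form_scale yform_def a_def b_def c_def z_def)
    have abc: "a\<^sup>2 \<in> IZ" "b\<^sup>2 \<in> IZ" "c\<^sup>2 \<in> IZ"
      using Yf_square ivj by (auto simp: a_def b_def c_def)
    have "a * b - c * b - z' * (a * c)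
        = (Const (1 / 2) * 2) * ((z * z') * (a * b - c * b) - z' * (a * c))"
      by (simp add: half zz)
    \<comment> \<open>Subtracting the squares leaves
      \<open>2 * z * (a * b - c * b) - 2 * a * c\<close>; the factor \<open>z'\<close> with one half
      turns this into the relation because \<open>z * z' = 1\<close>.\<close>
    also have "\<dots> = (Const (1 / 2) * z') * ((a + z * b - c)\<^sup>2 - a\<^sup>2 - z\<^sup>2 * b\<^sup>2 - c\<^sup>2)"
      by (simp add: algebra_simps power2_eq_square)
    also have "\<dots> \<in> IZ"
      unfolding z_def z'_def
      by (intro ideal_mult ideal_diff abc t[unfolded z_def] power_mem sym_carrier.mult sym_carrier.const)
    finally show ?thesis by (simp add: a_def b_def c_def z'_def)
  qed
qed

end

section \<open>The group action\<close>

text \<open>The complements of \<open>B\<close> and of its image have the same size. This extends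
  prescribed values on two or three indices to a permutation.\<close>

lemma ex_bij_betw_extension:
  assumes "finite A" "B \<subseteq> A" "inj_on f B" "f ` B \<subseteq> A"
  obtains g where "bij_betw g A A" "\<And>x. x \<in> B \<Longrightarrow> g x = f x"
proof -
  have fin: "finite B" using assms finite_subset by blast
  have "card (A - B) = card (A - f ` B)"
    using assms fin by (simp add: card_Diff_subset card_image)
  then obtain h where h: "bij_betw h (A - B) (A - f ` B)"
    using assms(1) by (meson finite_Diff finite_same_card_bij)
  define g where "g x = (if x \<in> B then f x else h x)" for x
  have "bij_betw g B (f ` B)"
    using assms(3) by (subst bij_betw_cong[of B g f]) (auto simp: g_def bij_betw_def)
  moreover have "bij_betw g (A - B) (A - f ` B)"
    using h by (subst bij_betw_cong[of "A - B" g h]) (auto simp: g_def)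
  ultimately have "bij_betw g (B \<union> (A - B)) (f ` B \<union> (A - f ` B))"
    by (rule bij_betw_combine) auto
  then have "bij_betw g A A"
    using assms(2,4) by (simp add: Un_absorb1)
  then show ?thesis using that by (auto simp: g_def)
qed

section \<open>Monomial matrices\<close>

definition monomial_mat :: "nat \<Rightarrow> nat \<Rightarrow> (nat \<Rightarrow> nat) \<Rightarrow> (nat \<Rightarrow> int) \<Rightarrow> complex mat" where
  "monomial_mat m n \<sigma> b = mat n n (\<lambda>(r, l). if r = \<sigma> l then omega m powi b l else 0)"

lemma monomial_mat_Gm1n:
  assumes "0 < m" "bij_betw \<sigma> {..<n} {..<n}"
  shows "monomial_mat m n \<sigma> b \<in> Gm1n m n"
proof -
  have \<sigma>: "\<sigma> l < n" if "l < n" for l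
    using assms(2) that by (auto simp: bij_betw_def)
  have inv: "\<exists>!l. l < n \<and> r = \<sigma> l" if "r < n" for r
    using assms(2) that unfolding bij_betw_def inj_on_def by (metis imageE lessThan_iff)
  have pow: "(omega m powi p) ^ m = 1" for p
  proof -
    have "(omega m powi p) ^ m = (omega m ^ m) powi p"
      by (simp add: power_int_def power_inverse mult.commute flip: power_mult)
    then show ?thesis using omega_root[OF assms(1)] by simp
  qed
  have entry: "monomial_mat m n \<sigma> b $$ (i, j) \<noteq> 0 \<longleftrightarrow> i = \<sigma> j" if "i < n" "j < n" for i j
    using that omega_nonzero[of m] by (simp add: monomial_mat_def)
  show ?thesis
    unfolding Gm1n_def
  proof (intro CollectI conjI allI impI)
    show "\<exists>!j. j < n \<and> monomial_mat m n \<sigma> b $$ (i, j) \<noteq> 0" if "i < n" for i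
      using inv[OF that] entry[OF that] by (simp cong: conj_cong)
    show "\<exists>!i. i < n \<and> monomial_mat m n \<sigma> b $$ (i, j) \<noteq> 0" if "j < n" for j
      using entry[OF _ that] \<sigma>[OF that] by (intro ex1I[of _ "\<sigma> j"]) auto
    show "monomial_mat m n \<sigma> b $$ (i, j) ^ m = 1"
      if "i < n" "j < n" "monomial_mat m n \<sigma> b $$ (i, j) \<noteq> 0" for i j
      using that pow by (auto simp: monomial_mat_def split: if_splits)
  qed (simp add: monomial_mat_def)
qed

text \<open>The columns define \<open>\<sigma>\<close>, the rows make it injective, and the
  exponents exist because every \<open>m\<close>-th root of unity is a power of
  \<open>omega m\<close>.\<close>

lemma Gm1n_monomial:
  assumes "0 < m" "M \<in> Gm1n m n"
  obtains \<sigma> b where "\<sigma> ` {..<n} \<subseteq> {..<n}" "inj_on \<sigma> {..<n}" "M = monomial_mat m n \<sigma> b"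
proof -
  have M: "M \<in> carrier_mat n n"
    and row: "\<And>i. i < n \<Longrightarrow> \<exists>!j. j < n \<and> M $$ (i, j) \<noteq> 0"
    and col: "\<And>j. j < n \<Longrightarrow> \<exists>!i. i < n \<and> M $$ (i, j) \<noteq> 0"
    and root: "\<And>i j. i < n \<Longrightarrow> j < n \<Longrightarrow> M $$ (i, j) \<noteq> 0 \<Longrightarrow> M $$ (i, j) ^ m = 1"
    using assms(2) unfolding Gm1n_def by auto
  obtain \<sigma> where \<sigma>: "\<And>l. l < n \<Longrightarrow> \<sigma> l < n \<and> M $$ (\<sigma> l, l) \<noteq> 0"
    using col by metis
  have "\<exists>p. M $$ (\<sigma> l, l) = omega m powi p" if l: "l < n" for l
  proof -
    obtain k where "M $$ (\<sigma> l, l) = omega m ^ k"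
      using omega_surj[OF assms(1)] root[of "\<sigma> l" l] \<sigma>[OF l] l by metis
    then show ?thesis by (intro exI[of _ "int k"]) simp
  qed
  then obtain b where b: "\<And>l. l < n \<Longrightarrow> M $$ (\<sigma> l, l) = omega m powi b l"
    by metis
  have "inj_on \<sigma> {..<n}"
    using \<sigma> row by (intro inj_onI) (metis lessThan_iff)
  moreover have "M = monomial_mat m n \<sigma> b"
  proof (rule eq_matI)
    show "M $$ (i, j) = monomial_mat m n \<sigma> b $$ (i, j)"
      if "i < dim_row (monomial_mat m n \<sigma> b)" "j < dim_col (monomial_mat m n \<sigma> b)" for i j
    proof -
      have ij: "i < n" "j < n" using that by (auto simp: monomial_mat_def)
      then have "M $$ (i, j) = 0" if "i \<noteq> \<sigma> j"
        using col[of j] \<sigma>[of j] that by blast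
      then show ?thesis using ij b[of j] by (auto simp: monomial_mat_def)
    qed
  qed (use M in \<open>auto simp: monomial_mat_def\<close>)
  moreover have "\<sigma> ` {..<n} \<subseteq> {..<n}" using \<sigma> by auto
  ultimately show ?thesis using that by blast
qed

lemma monomial_mat_mult_vec:
  assumes "dim_vec v = n" "r < n"
  shows "(monomial_mat m n \<sigma> b *\<^sub>v v) $ r = (\<Sum>l<n. if r = \<sigma> l then omega m powi b l * v $ l else 0)"
  using assms
  by (auto simp: monomial_mat_def mult_mat_vec_def scalar_prod_def lessThan_atLeast0 intro!: sum.cong)

lemma dim_normal_vec [simp]: "dim_vec (normal_vec m n g) = n"
  by (cases g) auto

text \<open>Every normal has leading entry 1, so the scalar and the first index can be read off; the
  second entry fixes the rest. This makes the description in \<open>act_basis\<close>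
  unique.\<close>

lemma normal_vec_unique:
  assumes m: "0 < m" and g: "g \<in> refls m n" "g' \<in> refls m n"
    and eq: "c \<cdot>\<^sub>v normal_vec m n g = d \<cdot>\<^sub>v normal_vec m n g'" and c: "c \<noteq> 0"
  shows "g = g' \<and> c = d"
proof -
  have e: "c * normal_vec m n g $ r = d * normal_vec m n g' $ r" if "r < n" for r
    using arg_cong[OF eq, of "\<lambda>v. v $ r"] that by simp
  have w: "omega m ^ k \<noteq> 0" for k using omega_nonzero by simp
  show ?thesis
  proof (cases g)
    case C: (Coord i)
    then show ?thesis
    proof (cases g')
      case (Coord i')
      then show ?thesis using C e[of i] e[of i'] g c by (auto simp: unit_vec_def split: if_splits)
    next
      case (Diff i' j' k')
      then show ?thesis
        using C e[of i] e[of i'] e[of j'] g c w[of k'] by (auto simp: unit_vec_def split: if_splits)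
    qed
  next
    case D: (Diff i j k)
    then show ?thesis
    proof (cases g')
      case (Coord i')
      then show ?thesis
        using D e[of i] e[of j] e[of i'] g c w[of k] by (auto simp: unit_vec_def split: if_splits)
    next
      case (Diff i' j' k')
      have ij: "i < j" "j < n" "k < m" "i' < j'" "j' < n" "k' < m" using D Diff g by auto
      have ii: "i = i'" "c = d"
        using D Diff e[of i] e[of i'] ij c by (auto simp: unit_vec_def split: if_splits)
      have jj: "j = j'" "omega m ^ k = omega m ^ k'"
        using D Diff e[of j] ii ij c w[of k] by (auto simp: unit_vec_def split: if_splits)
      show ?thesis using D Diff ii jj omega_inj[OF m ij(3,6) jj(2)] by simp
    qed
  qed
qed

lemma act_basis_eq:
  assumes "0 < m" "g' \<in> refls m n" "M *\<^sub>v normal_vec m n g = c \<cdot>\<^sub>v normal_vec m n g'" "c \<noteq> 0"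
  shows "act_basis m n M g = cvec_scale c (hvec g')"
  unfolding act_basis_def
proof (rule the_equality)
  show "\<exists>c'. \<exists>g''\<in>refls m n. M *\<^sub>v normal_vec m n g = c' \<cdot>\<^sub>v normal_vec m n g''
      \<and> cvec_scale c (hvec g') = cvec_scale c' (hvec g'')"
    using assms by blast
  fix v assume "\<exists>c'. \<exists>g''\<in>refls m n. M *\<^sub>v normal_vec m n g = c' \<cdot>\<^sub>v normal_vec m n g''
      \<and> v = cvec_scale c' (hvec g'')"
  then show "v = cvec_scale c (hvec g')"
    using normal_vec_unique[OF assms(1,2) _ _ assms(4)] assms(3) by metis
qed

lemma yform_eq:
  assumes "0 < m"
  shows "yform m i j k = Var (Coord i) - Const (omega m powi k) * Var (Coord j)
    - Const (diff_scale m i j k) * Var (diff_refl m i j k)"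
  unfolding yform_def using assms by (simp add: yvec_eq linear_form_diff linear_form_scale linear_form_hvec)

text \<open>The matrix maps \<open>e_i - \<omega>^k e_j\<close> to a multiple of
  \<open>e_i' - \<omega>^k' e_j'\<close> with \<open>i' = \<sigma> i\<close>,
  \<open>j' = \<sigma> j\<close> and \<open>k' = k + b j - b i\<close>: labels shift by differences
  of \<open>b\<close>.\<close>

lemma act_yform:
  assumes m: "0 < m" and \<sigma>: "\<sigma> ` {..<n} \<subseteq> {..<n}" "inj_on \<sigma> {..<n}"
    and ij: "i < n" "j < n" "i \<noteq> j"
  shows "act m n (monomial_mat m n \<sigma> b) (yform m i j k)
    = Const (omega m powi b i) * yform m (\<sigma> i) (\<sigma> j) (k + b j - b i)"
proof -
  let ?M = "monomial_mat m n \<sigma> b" and ?k = "k + b j - b i"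
  have \<sigma>ij: "\<sigma> i < n" "\<sigma> j < n" "\<sigma> i \<noteq> \<sigma> j"
    using \<sigma> ij by (auto simp: inj_on_def)
  have w: "omega m powi p \<noteq> 0" for p
    using omega_nonzero by simp
  have wk: "omega m powi b i * omega m powi ?k = omega m powi k * omega m powi b j"
    using omega_nonzero[of m] by (simp flip: power_int_add add: add.commute)
  have coord: "act_basis m n ?M (Coord l) = cvec_scale (omega m powi b l) (hvec (Coord (\<sigma> l)))"
    if l: "l < n" for l
  proof (rule act_basis_eq[OF m])
    show "?M *\<^sub>v normal_vec m n (Coord l) = omega m powi b l \<cdot>\<^sub>v normal_vec m n (Coord (\<sigma> l))"
    proof (rule eq_vecI)
      fix r assume "r < dim_vec (omega m powi b l \<cdot>\<^sub>v normal_vec m n (Coord (\<sigma> l)))"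
      then have r: "r < n" by simp
      have "(?M *\<^sub>v normal_vec m n (Coord l)) $ r
          = (\<Sum>l'<n. if l' = l then (if r = \<sigma> l then omega m powi b l else 0) else 0)"
        unfolding monomial_mat_mult_vec[OF dim_normal_vec r] using l
        by (intro sum.cong refl) (auto simp: unit_vec_def)
      then show "(?M *\<^sub>v normal_vec m n (Coord l)) $ r
          = (omega m powi b l \<cdot>\<^sub>v normal_vec m n (Coord (\<sigma> l))) $ r"
        using r l \<sigma>(1) by (auto simp: unit_vec_def)
    qed (simp add: monomial_mat_def)
  qed (use l \<sigma> w in auto)
  \<comment> \<open>Since \<open>\<sigma>\<close> may reverse the order of the ends, the scalars
    normalising the two normals can differ; their ratio enters.\<close>
  let ?c = "omega m powi b i * diff_scale m (\<sigma> i) (\<sigma> j) ?k / diff_scale m i j k"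
  have diff: "act_basis m n ?M (diff_refl m i j k) = cvec_scale ?c (hvec (diff_refl m (\<sigma> i) (\<sigma> j) ?k))"
  proof (rule act_basis_eq[OF m])
    show "?M *\<^sub>v normal_vec m n (diff_refl m i j k) = ?c \<cdot>\<^sub>v normal_vec m n (diff_refl m (\<sigma> i) (\<sigma> j) ?k)"
    proof (rule eq_vecI)
      fix r assume "r < dim_vec (?c \<cdot>\<^sub>v normal_vec m n (diff_refl m (\<sigma> i) (\<sigma> j) ?k))"
      then have r: "r < n" by simp
      let ?s = "diff_scale m i j k"
      \<comment> \<open>Scaling by \<open>?s\<close> brings the normal into the form of
        \<open>diff_normal\<close>, which is the same for both orders of the ends.\<close>
      have "?s * (?M *\<^sub>v normal_vec m n (diff_refl m i j k)) $ r
          = (\<Sum>l<n. if r = \<sigma> l then omega m powi b l * (?s * normal_vec m n (diff_refl m i j k) $ l) else 0)"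
        unfolding monomial_mat_mult_vec[OF dim_normal_vec r] sum_distrib_left
        by (intro sum.cong refl) auto
      also have "\<dots> = (\<Sum>l<n. (if l = i then if r = \<sigma> i then omega m powi b i else 0 else 0)
          - (if l = j then if r = \<sigma> j then omega m powi b j * omega m powi k else 0 else 0))"
        using ij by (intro sum.cong refl) (auto simp: diff_normal[OF m ij])
      also have "\<dots> = (if r = \<sigma> i then omega m powi b i else 0)
          - (if r = \<sigma> j then omega m powi b j * omega m powi k else 0)"
        using ij by (simp add: sum_subtractf)
      also have "\<dots> = omega m powi b i * ((if r = \<sigma> i then 1 else 0) - omega m powi ?k * (if r = \<sigma> j then 1 else 0))"
        using wk by (auto simp: right_diff_distrib)
      also have "\<dots> = omega m powi b i * (diff_scale m (\<sigma> i) (\<sigma> j) ?k * normal_vec m n (diff_refl m (\<sigma> i) (\<sigma> j) ?k) $ r)"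
        by (simp only: diff_normal[OF m \<sigma>ij r])
      finally show "(?M *\<^sub>v normal_vec m n (diff_refl m i j k)) $ r
          = (?c \<cdot>\<^sub>v normal_vec m n (diff_refl m (\<sigma> i) (\<sigma> j) ?k)) $ r"
        using diff_scale_nonzero[of m i j k] r by (simp add: field_simps)
    qed (simp add: monomial_mat_def)
  qed (use w diff_scale_nonzero diff_refl_in_refls[OF m \<sigma>ij] in auto)
  have "Const (diff_scale m i j k) * Const ?c
      = (Const (omega m powi b i) * Const (diff_scale m (\<sigma> i) (\<sigma> j) ?k) :: refl cpoly)"
    using diff_scale_nonzero[of m i j k] by (simp flip: Const_mult)
  moreover have "Const (omega m powi k) * Const (omega m powi b j)
      = (Const (omega m powi b i) * Const (omega m powi ?k) :: refl cpoly)"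
    using wk by (simp flip: Const_mult)
  ultimately show ?thesis
    unfolding act_def yform_eq[OF m]
    by (simp add: sym_map_diff sym_map_mult sym_map_Const sym_map_Var coord ij diff linear_form_scale
        linear_form_hvec right_diff_distrib flip: mult.assoc)
qed

section \<open>Group orbits of the generators of J_1 and J_2\<close>

context reflection_arrangement
begin

text \<open>The given generator of J_2 is the case \<open>p = q = 0\<close>. Up to scalars, the
  others are its images under the group; the factor on the middle term is the one that the action
  produces.\<close>

definition tri_gen :: "nat \<Rightarrow> nat \<Rightarrow> nat \<Rightarrow> int \<Rightarrow> int \<Rightarrow> refl cpoly" where
  "tri_gen i j l p q = Yf i j p * Yf j l q + Const (w powi q) * (Yf i l (p + q) * Yf l j (- q))
     + Yf j i (- p) * Yf i l (p + q)"

lemma tri_gen_eq: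
  assumes "distinct [i, j, l]"
  shows "tri_gen i j l p q = Yf i j p * Yf j l q - Yf i l (p + q) * Yf j l q
    - Const (w powi (- p)) * (Yf i j p * Yf i l (p + q))"
proof -
  have "Const (w powi q) * Yf l j (- q) = - Yf j l q"
    using gain.y_skew[of j l q] assms by simp
  moreover have "Yf j i (- p) = - (Const (w powi (- p)) * Yf i j p)"
    using gain.y_skew[of j i "- p"] assms by simp
  ultimately show ?thesis
    by (simp add: tri_gen_def mult.left_commute[of "Const (w powi q)"])
qed

text \<open>The labels shift by differences of \<open>b\<close>, so the shift of
  \<open>p + q\<close> is the sum of the two shifts; the shape is kept and a common scalar splits
  off.\<close>

lemma act_tri_gen:
  assumes "\<sigma> ` {..<n} \<subseteq> {..<n}" "inj_on \<sigma> {..<n}" "i < n" "j < n" "l < n" "distinct [i, j, l]"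
  shows "act m n (monomial_mat m n \<sigma> b) (tri_gen i j l p q)
    = Const (w powi (b i + b j)) * tri_gen (\<sigma> i) (\<sigma> j) (\<sigma> l) (p + b j - b i) (q + b l - b j)"
proof -
  let ?A = "act m n (monomial_mat m n \<sigma> b)"
  have hom: "?A (f + g) = ?A f + ?A g" "?A (f * g) = ?A f * ?A g" "?A (Const c) = Const c" for f g c
    by (simp_all add: act_def sym_map_add sym_map_mult sym_map_Const)
  have Y: "?A (Yf x y k) = Const (w powi b x) * Yf (\<sigma> x) (\<sigma> y) (k + b y - b x)"
    if "x < n" "y < n" "x \<noteq> y" for x y k
    using act_yform[OF m_pos assms(1,2) that] .
  \<comment> \<open>The middle term acquires a different scalar; divided by the common one, it is
    the new twisting factor.\<close>
  have ws: "w powi q * (w powi b i * w powi b l) = w powi (b i + b j) * w powi (q + b l - b j)"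
    using omega_nonzero[of m] by (simp flip: power_int_add add: algebra_simps)
  have ws': "w powi (b i + b j) = w powi b i * w powi b j"
    using omega_nonzero[of m] by (simp add: power_int_add)
  have C: "Const (w powi q) * (Const (w powi b i) * Const (w powi b l))
      = (Const (w powi (b i + b j)) * Const (w powi (q + b l - b j)) :: refl cpoly)"
    using ws by (simp flip: Const_mult)
  have "?A (tri_gen i j l p q) = Const (w powi (b i + b j)) * (Yf (\<sigma> i) (\<sigma> j) (p + b j - b i) * Yf (\<sigma> j) (\<sigma> l) (q + b l - b j))
    + Const (w powi q) * (Const (w powi b i) * Const (w powi b l)) * (Yf (\<sigma> i) (\<sigma> l) (p + q + b l - b i) * Yf (\<sigma> l) (\<sigma> j) (- q + b j - b l))
    + Const (w powi (b i + b j)) * (Yf (\<sigma> j) (\<sigma> i) (- p + b i - b j) * Yf (\<sigma> i) (\<sigma> l) (p + q + b l - b i))"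
    unfolding tri_gen_def hom using assms by (simp add: Y ws' Const_mult mult_ac)
  also have "\<dots> = Const (w powi (b i + b j)) * tri_gen (\<sigma> i) (\<sigma> j) (\<sigma> l) (p + b j - b i) (q + b l - b j)"
    unfolding C tri_gen_def by (simp add: algebra_simps)
  finally show ?thesis .
qed

text \<open>The action respects sums and products, so linear forms are the essential case; there the
  flow expansion reduces the claim to edges.\<close>

lemma act_mem:
  assumes "M \<in> Gm1n m n" "p \<in> S"
  shows "act m n M p \<in> S"
proof -
  obtain \<sigma> b where \<sigma>: "\<sigma> ` {..<n} \<subseteq> {..<n}" "inj_on \<sigma> {..<n}" and M: "M = monomial_mat m n \<sigma> b"
    using Gm1n_monomial[OF m_pos assms(1)] by metis
  show ?thesis
    using assms(2)
  proof induction
    case (linear u)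
    have "act m n M (linear_form u) = (\<Sum>(i, j, k)\<in>gain.upper. Const (coef u i j k) * act m n M (Yf i j k))"
      by (simp add: linear_form_Ker[OF linear] gain.lin_def act_def sym_map_sum case_prod_unfold
          sym_map_mult sym_map_Const)
    also have "\<dots> \<in> S"
    proof (rule sym_carrier_sum, clarify)
      fix i j k assume "(i, j, k) \<in> gain.upper"
      then have ij: "i < n" "j < n" "i \<noteq> j" by (auto simp: gain.upper_def)
      then have "\<sigma> i < n" "\<sigma> j < n" "\<sigma> i \<noteq> \<sigma> j" using \<sigma> by (auto simp: inj_on_def)
      then show "Const (coef u i j k) * act m n M (Yf i j k) \<in> S"
        unfolding M act_yform[OF m_pos \<sigma> ij] by (intro sym_carrier.mult sym_carrier.const Yf_mem)
    qed
    finally show ?case .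
  qed (auto simp: act_def sym_map_add sym_map_mult sym_map_Const intro: sym_carrier.intros)
qed

text \<open>The elements of \<open>S\<close> that a group element maps into the ideal form an ideal
  themselves, so stability may be tested on generators.\<close>

lemma W_stable_genideal:
  assumes G: "G \<subseteq> S"
    and act: "\<And>M g. M \<in> Gm1n m n \<Longrightarrow> g \<in> G \<Longrightarrow> act m n M g \<in> genideal (Sym K) G"
  shows "W_stable m n (genideal (Sym K) G)"
  unfolding W_stable_def
proof (intro ballI)
  fix M p assume M: "M \<in> Gm1n m n" and p: "p \<in> genideal (Sym K) G"
  let ?I = "genideal (Sym K) G" and ?A = "act m n M"
  interpret I: subring_ideal S ?I by (rule genideal_Sym(1)[OF G])
  have "?I \<subseteq> {p \<in> S. ?A p \<in> ?I}"
  proof (rule genideal_Sym(3)[OF G])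
    show "subring_ideal S {p \<in> S. ?A p \<in> ?I}"
    proof
      show "p * q \<in> {p \<in> S. ?A p \<in> ?I}" if "p \<in> S" "q \<in> {p \<in> S. ?A p \<in> ?I}" for p q
      proof -
        have "?A p * ?A q \<in> ?I" using that act_mem[OF M] by (intro I.ideal_mult) auto
        then show ?thesis using that by (auto simp: act_def sym_map_mult intro: sym_carrier.mult)
      qed
    qed (auto simp: act_def sym_map_add sym_map_0 intro: gain.one_mem gain.add_mem gain.uminus_mem
        gain.mult_mem gain.zero_mem I.ideal_zero I.ideal_add)
    show "G \<subseteq> {p \<in> S. ?A p \<in> ?I}" using G act[OF M] by auto
  qed
  then show "?A p \<in> ?I" using p by auto
qed

text \<open>The assumption \<open>orbit\<close> says that every stable ideal containing
  \<open>B\<close> picks up all of \<open>G\<close>.\<close>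

lemma W_ideal_eq_genideal:
  assumes G: "G \<subseteq> S" and stable: "W_stable m n (genideal (Sym K) G)"
    and B: "B \<subseteq> genideal (Sym K) G"
    and orbit: "\<And>I g. subring_ideal S I \<Longrightarrow> W_stable m n I \<Longrightarrow> B \<subseteq> I \<Longrightarrow> g \<in> G \<Longrightarrow> g \<in> I"
  shows "W_ideal m n B = genideal (Sym K) G"
proof
  show "W_ideal m n B \<subseteq> genideal (Sym K) G"
    unfolding W_ideal_def using genideal_Sym(1)[OF G] stable B by (auto simp: ideal_Sym_iff)
  show "genideal (Sym K) G \<subseteq> W_ideal m n B"
    unfolding W_ideal_def
  proof (rule Inter_greatest, clarify)
    fix I p assume I: "ideal I (Sym K)" "W_stable m n I" "B \<subseteq> I" "p \<in> genideal (Sym K) G"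
    then have "subring_ideal S I" by (simp add: ideal_Sym_iff)
    then show "p \<in> I" using genideal_Sym(3)[OF G, of I] orbit[of I] I by blast
  qed
qed

definition tri_gens :: "refl cpoly set" where
  "tri_gens = {tri_gen i j l p q | i j l p q. i < n \<and> j < n \<and> l < n \<and> distinct [i, j, l]}"

lemma tri_gens_I: "i < n \<Longrightarrow> j < n \<Longrightarrow> l < n \<Longrightarrow> distinct [i, j, l] \<Longrightarrow> tri_gen i j l p q \<in> tri_gens"
  unfolding tri_gens_def by blast

lemma tri_gens_S: "tri_gens \<subseteq> S"
proof
  fix g assume "g \<in> tri_gens"
  then obtain i j l p q where g: "g = tri_gen i j l p q" and ij: "i < n" "j < n" "l < n" "distinct [i, j, l]"
    unfolding tri_gens_def by blast
  show "g \<in> S"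
    unfolding g tri_gen_def
    using ij by (intro sym_carrier.add sym_carrier.mult Yf_mem sym_carrier.const) auto
qed

lemma const_cancel:
  assumes I: "subring_ideal S I" and "c \<noteq> 0" "Const c * p \<in> I"
  shows "p \<in> I"
proof -
  interpret I: subring_ideal S I by fact
  have "Const (inverse c) * (Const c * p) \<in> I"
    by (rule I.ideal_mult[OF sym_carrier.const assms(3)])
  then show ?thesis
    using assms(2) by (simp add: Const_1 flip: mult.assoc Const_mult)
qed

text \<open>The right-hand side does not mention \<open>i\<close>, \<open>j\<close>,
  \<open>k\<close>; hence J_2 is independent of their choice.\<close>

lemma J2_eq:
  assumes ijk: "i < n" "j < n" "k < n" "distinct [i, j, k]"
  shows "J2 m n i j k = genideal (Sym K) tri_gens"
proof -
  have B: "{yform m i j 0 * yform m j k 0 + yform m i k 0 * yform m k j 0 + yform m j i 0 * yform m i k 0}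
      = {tri_gen i j k 0 0}"
    by (simp add: tri_gen_def Const_1)
  show ?thesis
    unfolding J2_def B
  proof (rule W_ideal_eq_genideal[OF tri_gens_S])
    show "{tri_gen i j k 0 0} \<subseteq> genideal (Sym K) tri_gens"
      using genideal_Sym(2)[OF tri_gens_S] tri_gens_I[OF ijk] by blast
    show "W_stable m n (genideal (Sym K) tri_gens)"
    proof (rule W_stable_genideal[OF tri_gens_S])
      fix M g assume M: "M \<in> Gm1n m n" and g: "g \<in> tri_gens"
      obtain \<sigma> b where \<sigma>: "\<sigma> ` {..<n} \<subseteq> {..<n}" "inj_on \<sigma> {..<n}" and M: "M = monomial_mat m n \<sigma> b"
        using Gm1n_monomial[OF m_pos M] by metis
      obtain x y z p q where g: "g = tri_gen x y z p q" and xyz: "x < n" "y < n" "z < n" "distinct [x, y, z]"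
        using g unfolding tri_gens_def by blast
      have "tri_gen (\<sigma> x) (\<sigma> y) (\<sigma> z) p' q' \<in> tri_gens" for p' q'
        using xyz \<sigma> by (intro tri_gens_I) (auto simp: inj_on_def)
      then show "act m n M g \<in> genideal (Sym K) tri_gens"
        unfolding g M act_tri_gen[OF \<sigma> xyz]
        using subring_ideal.ideal_mult[OF genideal_Sym(1)[OF tri_gens_S] sym_carrier.const]
          genideal_Sym(2)[OF tri_gens_S] by blast
    qed
    fix I g assume I: "subring_ideal S I" "W_stable m n I" "{tri_gen i j k 0 0} \<subseteq> I" and g: "g \<in> tri_gens"
    obtain x y z p q where g: "g = tri_gen x y z p q" and xyz: "x < n" "y < n" "z < n" "distinct [x, y, z]"
      using g unfolding tri_gens_def by blast
    define f where "f = (\<lambda>l. if l = i then x else if l = j then y else z)"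
    have "inj_on f {i, j, k}" "f ` {i, j, k} \<subseteq> {..<n}"
      using ijk xyz by (auto simp: f_def inj_on_def)
    then obtain \<sigma> where \<sigma>: "bij_betw \<sigma> {..<n} {..<n}" and f: "\<And>l. l \<in> {i, j, k} \<Longrightarrow> \<sigma> l = f l"
      using ijk by (metis ex_bij_betw_extension[of "{..<n}" "{i, j, k}" f] finite_lessThan
          empty_subsetI insert_subset lessThan_iff)
    have \<sigma>': "\<sigma> ` {..<n} \<subseteq> {..<n}" "inj_on \<sigma> {..<n}"
      using \<sigma> by (auto simp: bij_betw_def)
    have eq: "\<sigma> i = x" "\<sigma> j = y" "\<sigma> k = z" using f ijk by (auto simp: f_def)
    \<comment> \<open>Chosen so that \<open>b j - b i = p\<close> and \<open>b k - b j = q\<close>,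
      the labels to be reached from zero.\<close>
    define b where "b = (\<lambda>l. if l = i then 0 else if l = j then p else p + q)"
    have "act m n (monomial_mat m n \<sigma> b) (tri_gen i j k 0 0) = Const (w powi p) * tri_gen x y z p q"
      unfolding act_tri_gen[OF \<sigma>' ijk] eq using ijk by (simp add: b_def)
    moreover have "act m n (monomial_mat m n \<sigma> b) (tri_gen i j k 0 0) \<in> I"
      using I monomial_mat_Gm1n[OF m_pos \<sigma>] by (auto simp: W_stable_def)
    ultimately show "g \<in> I"
      unfolding g using const_cancel[OF I(1), of "w powi p"] omega_nonzero by auto
  qed
qed

abbreviation par_gens :: "refl cpoly set" where
  "par_gens \<equiv> {yform m i j (int k) * yform m i j (int k') | i j k k'. i < j \<and> j < n \<and> k < m \<and> k' < m}"

lemma par_gens_S: "par_gens \<subseteq> S"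
proof clarify
  fix i j k k' :: nat assume "i < j" "j < n"
  then show "Yf i j (int k) * Yf i j (int k') \<in> S"
    by (intro sym_carrier.mult Yf_mem) auto
qed

lemma J1_ideal: "subring_ideal S (J1 m n)"
  unfolding J1_def by (rule genideal_Sym(1)[OF par_gens_S])

text \<open>The generators have increasing ends and reduced labels; periodicity and skewness extend
  membership to all edges.\<close>

lemma parallel_J1:
  assumes "i < n" "j < n" "i \<noteq> j"
  shows "Yf i j p * Yf i j q \<in> J1 m n"
proof -
  interpret J: subring_ideal S "J1 m n" by (rule J1_ideal)
  have *: "Yf i j p * Yf i j q \<in> J1 m n" if "i < j" "j < n" for i j p q
  proof -
    have "nat (p mod int m) < m" "nat (q mod int m) < m"
      using m_pos by (auto simp: nat_less_iff)
    then have "Yf i j (int (nat (p mod int m))) * Yf i j (int (nat (q mod int m))) \<in> par_gens"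
      using that by blast
    then have "Yf i j (int (nat (p mod int m))) * Yf i j (int (nat (q mod int m))) \<in> J1 m n"
      using genideal_Sym(2)[OF par_gens_S] unfolding J1_def by blast
    then show ?thesis using m_pos by (simp add: gain.y_mod)
  qed
  show ?thesis
  proof (cases "i < j")
    case True
    then show ?thesis using * assms by simp
  next
    case False
    then have "j < i" using assms by simp
    have "Yf i j p * Yf i j q = (Const (w powi p) * Const (w powi q)) * (Yf j i (- p) * Yf j i (- q))"
      using gain.y_skew[of i j p] gain.y_skew[of i j q] assms by (simp add: mult_ac)
    also have "\<dots> \<in> J1 m n"
      using \<open>j < i\<close> assms by (intro J.ideal_mult sym_carrier.mult sym_carrier.const *)
    finally show ?thesis .
  qed
qed

lemma act_parallel:
  assumes "\<sigma> ` {..<n} \<subseteq> {..<n}" "inj_on \<sigma> {..<n}" "i < n" "j < n" "i \<noteq> j"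
  shows "act m n (monomial_mat m n \<sigma> b) (Yf i j p * Yf i j q) = Const (w powi b i * w powi b i)
    * (Yf (\<sigma> i) (\<sigma> j) (p + b j - b i) * Yf (\<sigma> i) (\<sigma> j) (q + b j - b i))"
proof -
  have "act m n (monomial_mat m n \<sigma> b) (Yf i j p * Yf i j q)
      = act m n (monomial_mat m n \<sigma> b) (Yf i j p) * act m n (monomial_mat m n \<sigma> b) (Yf i j q)"
    by (simp add: act_def sym_map_mult)
  then show ?thesis
    unfolding act_yform[OF m_pos assms] by (simp add: Const_mult mult_ac)
qed

text \<open>The group maps parallel products to scalar multiples of parallel products, which gives
  stability. Conversely, permutation matrices keep the labels and move the ends \<open>0\<close>,
  \<open>1\<close> to any \<open>i\<close>, \<open>j\<close>.\<close>

lemma J1_eq_W_ideal: "J1 m n = W_ideal m n {Yf 0 1 (int k) * Yf 0 1 (int k') | k k'. k < m \<and> k' < m}"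
  (is "_ = W_ideal m n ?B")
  unfolding J1_def
proof (rule W_ideal_eq_genideal[symmetric, OF par_gens_S])
  have "Yf 0 1 (int k) * Yf 0 1 (int k') \<in> par_gens" if "k < m" "k' < m" for k k'
    using that n_ge by (intro CollectI exI[of _ 0] exI[of _ 1] exI[of _ k] exI[of _ k']) simp
  then show "?B \<subseteq> genideal (Sym K) par_gens" using genideal_Sym(2)[OF par_gens_S] by blast
  show "W_stable m n (genideal (Sym K) par_gens)"
  proof (rule W_stable_genideal[OF par_gens_S])
    fix M g assume M: "M \<in> Gm1n m n" and g: "g \<in> par_gens"
    obtain \<sigma> b where \<sigma>: "\<sigma> ` {..<n} \<subseteq> {..<n}" "inj_on \<sigma> {..<n}" and M: "M = monomial_mat m n \<sigma> b"
      using Gm1n_monomial[OF m_pos M] by metis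
    obtain i j k k' where g: "g = Yf i j (int k) * Yf i j (int k')" and "i < j" "j < n"
      using g by blast
    then have ij: "i < n" "j < n" "i \<noteq> j" by auto
    have "\<sigma> i < n" "\<sigma> j < n" "\<sigma> i \<noteq> \<sigma> j" using \<sigma> ij by (auto simp: inj_on_def)
    then show "act m n M g \<in> genideal (Sym K) par_gens"
      unfolding g M act_parallel[OF \<sigma> ij] J1_def[symmetric]
      by (intro subring_ideal.ideal_mult[OF J1_ideal] sym_carrier.const parallel_J1)
  qed
  fix I g assume I: "subring_ideal S I" "W_stable m n I" "?B \<subseteq> I" and g: "g \<in> par_gens"
  obtain i j k k' where g: "g = Yf i j (int k) * Yf i j (int k')" and ij: "i < j" "j < n" "k < m" "k' < m"
    using g by blast
  define f where "f = (\<lambda>l :: nat. if l = 0 then i else j)"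
  have "inj_on f {0, 1}" "f ` {0, 1} \<subseteq> {..<n}" "{0, 1} \<subseteq> {..<n}"
    using ij n_ge by (auto simp: f_def inj_on_def)
  then obtain \<sigma> where \<sigma>: "bij_betw \<sigma> {..<n} {..<n}" and f: "\<And>l. l \<in> {0, 1} \<Longrightarrow> \<sigma> l = f l"
    by (metis ex_bij_betw_extension[of "{..<n}" "{0, 1}" f] finite_lessThan)
  have \<sigma>': "\<sigma> ` {..<n} \<subseteq> {..<n}" "inj_on \<sigma> {..<n}"
    using \<sigma> by (auto simp: bij_betw_def)
  have eq: "\<sigma> 0 = i" "\<sigma> 1 = j" using f by (auto simp: f_def)
  have "act m n (monomial_mat m n \<sigma> (\<lambda>_. 0)) (Yf 0 1 (int k) * Yf 0 1 (int k')) = g"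
    using n_ge eq by (subst act_parallel[OF \<sigma>']) (auto simp: g Const_1)
  moreover have "act m n (monomial_mat m n \<sigma> (\<lambda>_. 0)) (Yf 0 1 (int k) * Yf 0 1 (int k')) \<in> I"
    using I(2,3) ij monomial_mat_Gm1n[OF m_pos \<sigma>] unfolding W_stable_def by blast
  ultimately show "g \<in> I" by simp
qed

section \<open>Equality of the zonotopal ideal with the sum\<close>

lemma I_eq: "IZ = J1 m n <+>\<^bsub>Sym K\<^esub> genideal (Sym K) tri_gens"
proof -
  let ?T = "genideal (Sym K) tri_gens" and ?J = "J1 m n <+>\<^bsub>Sym K\<^esub> genideal (Sym K) tri_gens"
  interpret R: cring "Sym K" by (rule cring_Sym)
  interpret J1: subring_ideal S "J1 m n" by (rule J1_ideal)
  interpret T: subring_ideal S ?T by (rule genideal_Sym(1)[OF tri_gens_S])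
  interpret I: gain_algebra S IZ Const "omega m" m n "yform m" by (rule gain_I)
  have J: "subring_ideal S ?J"
    using R.add_ideals J1_ideal genideal_Sym(1)[OF tri_gens_S] by (simp flip: ideal_Sym_iff)
  have mem: "p \<in> ?J \<longleftrightarrow> (\<exists>a\<in>J1 m n. \<exists>b\<in>?T. p = a + b)" for p
    by (auto simp: set_add_def' Sym_def)
  have sub: "J1 m n \<subseteq> ?J" "?T \<subseteq> ?J"
    using J1.ideal_zero T.ideal_zero by (force simp: mem)+
  show ?thesis
  proof
    \<comment> \<open>Once the sum satisfies both relations, \<open>linear_form_power\<close> puts
      every generator of the zonotopal ideal into it.\<close>
    have "gain_algebra S ?J Const w m n Yf"
    proof (rule gain_algebraI[OF J])
      show "Yf i j p * Yf i j q \<in> ?J" if "i < n" "j < n" "i \<noteq> j" for i j p q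
        using parallel_J1[OF that] sub by blast
      show "Yf i v p * Yf v j q - Yf i j (p + q) * Yf v j q
          - Const (w powi (- p)) * (Yf i v p * Yf i j (p + q)) \<in> ?J"
        if "i < n" "v < n" "j < n" "distinct [i, v, j]" for i v j p q
      proof -
        have "tri_gen i v j p q \<in> tri_gens" using that by (rule tri_gens_I)
        then show ?thesis
          using genideal_Sym(2)[OF tri_gens_S] sub tri_gen_eq[OF that(4)] by auto
      qed
    qed
    then show "IZ \<subseteq> ?J"
      by (intro I_minimal[OF J] linear_form_power)
    \<comment> \<open>Conversely, \<open>gain_I\<close> says that the zonotopal ideal contains the
      generators of both summands.\<close>
    have "J1 m n \<subseteq> IZ"
      unfolding J1_def
      by (rule genideal_Sym(3)[OF par_gens_S I_ideal]) (auto intro!: I.parallel)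
    moreover have "?T \<subseteq> IZ"
    proof (rule genideal_Sym(3)[OF tri_gens_S I_ideal], rule subsetI)
      fix g assume "g \<in> tri_gens"
      then obtain i v j p q where "g = tri_gen i v j p q" "i < n" "v < n" "j < n" "distinct [i, v, j]"
        unfolding tri_gens_def by blast
      then show "g \<in> IZ" using I.triangle[of i v j p q] by (simp add: tri_gen_eq)
    qed
    ultimately show "?J \<subseteq> IZ"
      using I.ideal_add by (force simp: mem)
  qed
qed

end

theorem theorem7p1:
  fixes m n :: nat
  assumes "m \<ge> 2" and "n \<ge> 3"
  shows "(\<forall>i<n. \<forall>j<n. \<forall>k<n. distinct [i, j, k] \<longrightarrow>
            internal_zonotopal_ideal (Ker m n) (G_perp m n)
              = J1 m n <+>\<^bsub>Sym (Ker m n)\<^esub> J2 m n i j k)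
       \<and> (\<forall>i<n. \<forall>j<n. \<forall>k<n. \<forall>i'<n. \<forall>j'<n. \<forall>k'<n.
            distinct [i, j, k] \<longrightarrow> distinct [i', j', k'] \<longrightarrow> J2 m n i j k = J2 m n i' j' k')
       \<and> J1 m n = W_ideal m n {yform m 0 1 (int k) * yform m 0 1 (int k') | k k'. k < m \<and> k' < m}"
proof -
  interpret reflection_arrangement m n
    using assms by unfold_locales
  show ?thesis
    using I_eq J1_eq_W_ideal by (auto simp: J2_eq simp del: distinct.simps)
qed

end
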